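(* Let $G$ be a $2$-connected (finite, simple) graph with minimum degree $\delta\geq 6$ and order $n\geq 2\delta+4$. If $\rho(G)\geq \rho(B_{n,\delta+1}^{2})$, then $G$ is rigid in $\mathbb{R}^2$ unless $G\cong B_{n,\delta+1}^{2}$.
   Context: For a graph $G$, $\rho(G)$ denotes the spectral radius, i.e. the largest eigenvalue of its adjacency matrix $A(G)$. For integers $n> n_1\geq 1$ and $i\geq 1$, $B_{n,n_1}^{i}$ denotes the graph obtained from the disjoint union $K_{n_1}\cup K_{n-n_1}$ of two complete graphs by adding $i$ pairwise independent edges (a matching of size $i$) between $K_{n_1}$ and $K_{n-n_1}$. A $2$-dimensional framework $(G,p)$ is a graph $G=(V,E)$ together with a map $p:V\to\mathbb{R}^2$. Two frameworks $(G,p)$ and $(G,q)$ are equivalent if $\|p(u)-p(v)\|=\|q(u)-q(v)\|$ for every edge $uv\in E$, and congruent if this holds for every pair $u,v\in V$. A framework is generic if the coordinates of its points are algebraically independent over $\mathbb{Q}$. A graph $G$ is rigid in $\mathbb{R}^2$ if for every generic $2$-dimensional framework $(G,p)$ there is $\varepsilon>0$ such that every framework $(G,q)$ equivalent to $(G,p)$ with $\|p(u)-q(u)\|<\varepsilon$ for all $u\in V$ is congruent to $(G,p)$. *)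

theory Defs
  imports
    "HOL-Analysis.Analysis"
    "HOL-Library.Poly_Mapping"
    "Jordan_Normal_Form.Char_Poly"
    "Graph_Theory.Graph_Theory"
begin

text \<open>
  A finite simple graph is a \<open>pair_graph\<close>: a finite vertex set with a symmetric irreflexive arc
  relation. An edge \<open>uv\<close> is thus represented by both arcs \<open>(u, v)\<close> and \<open>(v, u)\<close>, so the degree
  of a vertex is its \<open>out_degree\<close>, and \<open>digraph_iso\<close> is isomorphism of simple graphs.
  Records of type \<open>pair_pre_digraph\<close> are coerced by \<open>with_proj\<close> to \<open>pre_digraph\<close>.
\<close>

definition min_degree :: "'a pair_pre_digraph \<Rightarrow> nat" where
  "min_degree G = Min (out_degree G ` pverts G)"

definition k_vertex_connected :: "nat \<Rightarrow> 'a pair_pre_digraph \<Rightarrow> bool" where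
  "k_vertex_connected k G \<longleftrightarrow>
     k < card (pverts G) \<and>
     (\<forall>X \<subseteq> pverts G. card X < k \<longrightarrow>
        Digraph_Component.connected (with_proj G \<restriction> (pverts G - X)))"

text \<open>
  The rows and columns of the adjacency matrix follow an arbitrary fixed enumeration of the
  vertices. Its eigenvalues do not depend on that choice, see
  \<open>eigenvalue_adjacency_matrix_iff\<close> below.
\<close>

definition vertex_list :: "'a pair_pre_digraph \<Rightarrow> 'a list" where
  "vertex_list G = (SOME vs. distinct vs \<and> set vs = pverts G)"

definition adjacency_matrix :: "'a pair_pre_digraph \<Rightarrow> real Matrix.mat" where
  "adjacency_matrix G =
     (let vs = vertex_list G; n = length vs
      in Matrix.mat n n (\<lambda>(i, j). if (vs ! i, vs ! j) \<in> parcs G then 1 else 0))"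

definition graph_spectral_radius :: "'a pair_pre_digraph \<Rightarrow> real" where
  "graph_spectral_radius G = Max {k. eigenvalue (adjacency_matrix G) k}"

text \<open>
  The vertices \<open>0, ..., n1 - 1\<close> and \<open>n1, ..., n - 1\<close> carry the two complete graphs, and the
  matching joins \<open>j\<close> with \<open>n1 + j\<close> for \<open>j < i\<close>. This is meaningful for \<open>1 \<le> n1 < n\<close> and
  \<open>i \<le> min n1 (n - n1)\<close>.
\<close>

definition B_graph :: "nat \<Rightarrow> nat \<Rightarrow> nat \<Rightarrow> nat pair_pre_digraph" where
  "B_graph n n1 i =
     \<lparr> pverts = {..<n},
       parcs = {(u, v). u < n1 \<and> v < n1 \<and> u \<noteq> v}
             \<union> {(u, v). n1 \<le> u \<and> u < n \<and> n1 \<le> v \<and> v < n \<and> u \<noteq> v}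
             \<union> {(j, n1 + j) | j. j < i} \<union> {(n1 + j, j) | j. j < i} \<rparr>"

text \<open>
  A polynomial with rational coefficients in variables indexed by \<open>'i\<close> is a finitely supported
  map from monomials to coefficients, a monomial being a finitely supported map from variables
  to exponents.
\<close>

definition poly_eval :: "('i \<Rightarrow> real) \<Rightarrow> (('i \<Rightarrow>\<^sub>0 nat) \<Rightarrow>\<^sub>0 rat) \<Rightarrow> real" where
  "poly_eval x P =
     (\<Sum>m\<in>Poly_Mapping.keys P. of_rat (Poly_Mapping.lookup P m) *
        (\<Prod>i\<in>Poly_Mapping.keys m. x i ^ Poly_Mapping.lookup m i))"

definition algebraically_independent_over_rat :: "'i set \<Rightarrow> ('i \<Rightarrow> real) \<Rightarrow> bool" where
  "algebraically_independent_over_rat I x \<longleftrightarrow>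
     (\<forall>P. (\<forall>m\<in>Poly_Mapping.keys P. Poly_Mapping.keys m \<subseteq> I) \<and> P \<noteq> 0 \<longrightarrow> poly_eval x P \<noteq> 0)"

text \<open>
  A framework is a graph with a placement \<open>p\<close> of its vertices; values of \<open>p\<close> outside the vertex
  set play no role.
\<close>

definition generic_framework :: "'a pair_pre_digraph \<Rightarrow> ('a \<Rightarrow> real ^ 2) \<Rightarrow> bool" where
  "generic_framework G p \<longleftrightarrow>
     algebraically_independent_over_rat (pverts G \<times> UNIV) (\<lambda>(v, c). vec_nth (p v) c)"

definition equivalent_frameworks ::
    "'a pair_pre_digraph \<Rightarrow> ('a \<Rightarrow> real ^ 2) \<Rightarrow> ('a \<Rightarrow> real ^ 2) \<Rightarrow> bool" where
  "equivalent_frameworks G p q \<longleftrightarrow>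
     (\<forall>(u, v) \<in> parcs G. norm (p u - p v) = norm (q u - q v))"

definition congruent_frameworks ::
    "'a pair_pre_digraph \<Rightarrow> ('a \<Rightarrow> real ^ 2) \<Rightarrow> ('a \<Rightarrow> real ^ 2) \<Rightarrow> bool" where
  "congruent_frameworks G p q \<longleftrightarrow>
     (\<forall>u \<in> pverts G. \<forall>v \<in> pverts G. norm (p u - p v) = norm (q u - q v))"

definition rigid_in_plane :: "'a pair_pre_digraph \<Rightarrow> bool" where
  "rigid_in_plane G \<longleftrightarrow>
     (\<forall>p. generic_framework G p \<longrightarrow>
        (\<exists>\<epsilon>>0. \<forall>q. equivalent_frameworks G p q \<and> (\<forall>u \<in> pverts G. norm (p u - q u) < \<epsilon>) \<longrightarrow>
           congruent_frameworks G p q))"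

lemma pair_graph_B_graph:
  assumes "n1 < n" "i \<le> n1" "i \<le> n - n1"
  shows "pair_graph (B_graph n n1 i)"
proof -
  let ?B = "B_graph n n1 i"
  have sub: "parcs ?B \<subseteq> {..<n} \<times> {..<n}"
    using assms by (auto simp: B_graph_def)
  have v: "pverts ?B = {..<n}" by (simp add: B_graph_def)
  have fin: "finite (parcs ?B)" using sub by (rule finite_subset) simp
  have sym: "symmetric ?B"
    unfolding symmetric_def with_proj_simps by (rule symI) (auto simp: B_graph_def)
  have irr: "fst e \<noteq> snd e" if "e \<in> parcs ?B" for e
    using that assms by (auto simp: B_graph_def)
  show ?thesis
    using sub fin sym irr by unfold_locales (auto simp: v)
qed

lemma vertex_list:
  assumes "finite (pverts G)"
  shows "distinct (vertex_list G)" "set (vertex_list G) = pverts G"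
proof -
  have "\<exists>vs. distinct vs \<and> set vs = pverts G"
    using finite_distinct_list[OF assms] by blast
  then have "distinct (vertex_list G) \<and> set (vertex_list G) = pverts G"
    unfolding vertex_list_def by (rule someI_ex)
  then show "distinct (vertex_list G)" "set (vertex_list G) = pverts G" by auto
qed

lemma eigenvalue_adjacency_matrix_iff:
  assumes fin: "finite (pverts G)"
  shows "eigenvalue (adjacency_matrix G) k \<longleftrightarrow>
    (\<exists>x. (\<exists>u\<in>pverts G. x u \<noteq> 0) \<and>
         (\<forall>u\<in>pverts G. (\<Sum>v\<in>{v \<in> pverts G. (u, v) \<in> parcs G}. x v) = k * x u))"
proof -
  define vs where "vs = vertex_list G"
  define n where "n = length vs"
  let ?A = "adjacency_matrix G"
  note vl = vertex_list[OF fin, folded vs_def]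
  have bij: "bij_betw (\<lambda>i. vs ! i) {0..<n} (pverts G)"
    using bij_betw_nth[OF vl(1) refl refl] vl(2) by (simp add: n_def lessThan_atLeast0)
  have dim: "dim_row ?A = n" "dim_col ?A = n"
    by (simp_all add: adjacency_matrix_def Let_def n_def vs_def)
  have row: "vec_index (mult_mat_vec ?A (Matrix.vec n (\<lambda>i. x (vs ! i)))) i =
      (\<Sum>v\<in>{v \<in> pverts G. (vs ! i, v) \<in> parcs G}. x v)" if i: "i < n" for x i
  proof -
    have "vec_index (mult_mat_vec ?A (Matrix.vec n (\<lambda>i. x (vs ! i)))) i =
        (\<Sum>j\<in>{0..<n}. (if (vs ! i, vs ! j) \<in> parcs G then 1 else 0) * x (vs ! j))"
      using i by (simp add: scalar_prod_def dim adjacency_matrix_def Let_def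
          flip: vs_def n_def)
    also have "\<dots> = (\<Sum>v\<in>pverts G. (if (vs ! i, v) \<in> parcs G then 1 else 0) * x v)"
      by (rule sum.reindex_bij_betw[OF bij])
    also have "\<dots> = (\<Sum>v\<in>{v \<in> pverts G. (vs ! i, v) \<in> parcs G}. x v)"
      using fin by (subst sum.inter_filter) (auto intro!: sum.cong)
    finally show ?thesis .
  qed
  have all_iff: "(\<forall>u\<in>pverts G. P u) \<longleftrightarrow> (\<forall>i<n. P (vs ! i))" for P
    unfolding n_def vl(2)[symmetric] by (rule all_set_conv_all_nth)
  have ev: "eigenvector ?A (Matrix.vec n (\<lambda>i. x (vs ! i))) k \<longleftrightarrow>
      (\<exists>u\<in>pverts G. x u \<noteq> 0) \<and>
      (\<forall>u\<in>pverts G. (\<Sum>v\<in>{v \<in> pverts G. (u, v) \<in> parcs G}. x v) = k * x u)" for x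
  proof -
    have "Matrix.vec n (\<lambda>i. x (vs ! i)) = 0\<^sub>v n \<longleftrightarrow> (\<forall>u\<in>pverts G. x u = 0)"
      unfolding all_iff by (auto simp: Matrix.vec_eq_iff)
    moreover have "mult_mat_vec ?A (Matrix.vec n (\<lambda>i. x (vs ! i))) =
        k \<cdot>\<^sub>v Matrix.vec n (\<lambda>i. x (vs ! i)) \<longleftrightarrow>
        (\<forall>u\<in>pverts G. (\<Sum>v\<in>{v \<in> pverts G. (u, v) \<in> parcs G}. x v) = k * x u)"
      unfolding all_iff Matrix.vec_eq_iff using row by (simp add: dim del: index_mult_mat_vec)
    ultimately show ?thesis by (auto simp: eigenvector_def dim)
  qed
  have "\<exists>x. y = Matrix.vec n (\<lambda>i. x (vs ! i))" if "y \<in> carrier_vec n" for y :: "real Matrix.vec"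
  proof
    show "y = Matrix.vec n (\<lambda>i. (\<lambda>v. vec_index y (the_inv_into {0..<n} (\<lambda>i. vs ! i) v)) (vs ! i))"
      using that bij by (auto simp: Matrix.vec_eq_iff bij_betw_def the_inv_into_f_f)
  qed
  then have "eigenvalue ?A k \<longleftrightarrow> (\<exists>x. eigenvector ?A (Matrix.vec n (\<lambda>i. x (vs ! i))) k)"
    unfolding eigenvalue_def by (metis dim(1) eigenvector_def)
  then show ?thesis by (simp only: ev)
qed

end

(*
  If G is not rigid then, by Laman's theorem, its edges are covered by vertex sets X (the rigid
  components) that pairwise share at most one vertex, with sum of (2 |X| - 3) at most 2 n - 4.
  On the other hand rho(G) >= rho(B) > n - delta - 2, so the bound of Hong, Shu and Fang gives G
  more edges than the disjoint union of two complete graphs on delta + 1 and n - delta - 1 vertices.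
  By convexity so many edges are possible only if two components partition the vertex set and
  exactly two independent edges join them. Either the parts have delta + 1 and n - delta - 1
  vertices, so that G is a spanning subgraph of B and strict monotonicity of the spectral radius
  yields G = B, or both parts have delta + 2 vertices, so that rho(G) is at most the maximum
  degree delta + 2 = n - delta - 2, which is less than rho(B).
*)

theory Submission
  imports Defs "Jordan_Normal_Form.Spectral_Radius"
begin

section \<open>Rational polynomial functions\<close>

text \<open>Rigidity is demanded at every generic placement, yet genericity enters in one way only:
  a rational polynomial in the coordinates that is nonzero at one convenient placement, however
  degenerate, is nonzero at the generic one. The Gram determinant of rows of the rigidity matrix
  puts the independence of a set of edges into this form. The extremal count is decided by a margin
  of one edge. The graph has at least one edge more than the two complete graphs on \<delta> + 1 and
  n - \<delta> - 1 vertices. Complete graphs on s and y = n - s vertices have (s - \<delta> - 1) *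
  (y - \<delta> - 1) edges fewer than those, and the two joining edges leave room for a loss of at
  most 1. A loss of 0 gives the parts of B; a loss of 1 gives two parts of \<delta> + 2 vertices,
  which counting alone cannot exclude. Other covers are excluded by comparing edges with weights:
  the ratio a * (a - 1) / (2 * a - 3) does not decrease as the integer a \<ge> 2 grows.\<close>

lemma poly_eval_superset:
  assumes "finite S" "Poly_Mapping.keys P \<subseteq> S"
  shows "poly_eval x P = (\<Sum>m\<in>S. of_rat (Poly_Mapping.lookup P m) *
        (\<Prod>i\<in>Poly_Mapping.keys m. x i ^ Poly_Mapping.lookup m i))"
  unfolding poly_eval_def using assms
  by (intro sum.mono_neutral_left) (auto simp: in_keys_iff)

lemma poly_eval_add: "poly_eval x (P + Q) = poly_eval x P + poly_eval x Q"
proof -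
  let ?S = "Poly_Mapping.keys P \<union> Poly_Mapping.keys Q"
  have "poly_eval x (P + Q) = (\<Sum>m\<in>?S. of_rat (Poly_Mapping.lookup (P + Q) m) *
        (\<Prod>i\<in>Poly_Mapping.keys m. x i ^ Poly_Mapping.lookup m i))"
    using Poly_Mapping.keys_add[of P Q] by (intro poly_eval_superset) auto
  also have "\<dots> = poly_eval x P + poly_eval x Q"
    by (simp add: poly_eval_superset[of ?S] lookup_add of_rat_add algebra_simps sum.distrib)
  finally show ?thesis .
qed

lemma poly_eval_single:
  "poly_eval x (Poly_Mapping.single m c) =
     of_rat c * (\<Prod>i\<in>Poly_Mapping.keys m. x i ^ Poly_Mapping.lookup m i)"
  by (subst poly_eval_superset[of "{m}"]) auto

lemma monomial_eval_add:
  fixes m m' :: "'i \<Rightarrow>\<^sub>0 nat" and x :: "'i \<Rightarrow> real"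
  shows "(\<Prod>i\<in>Poly_Mapping.keys (m + m'). x i ^ Poly_Mapping.lookup (m + m') i) =
    (\<Prod>i\<in>Poly_Mapping.keys m. x i ^ Poly_Mapping.lookup m i) *
    (\<Prod>i\<in>Poly_Mapping.keys m'. x i ^ Poly_Mapping.lookup m' i)"
proof -
  let ?S = "Poly_Mapping.keys m \<union> Poly_Mapping.keys m'"
  have eq: "(\<Prod>i\<in>Poly_Mapping.keys k. x i ^ Poly_Mapping.lookup k i) =
      (\<Prod>i\<in>?S. x i ^ Poly_Mapping.lookup k i)" if "Poly_Mapping.keys k \<subseteq> ?S" for k
    using that by (intro prod.mono_neutral_left) (auto simp: in_keys_iff)
  have "(\<Prod>i\<in>?S. x i ^ Poly_Mapping.lookup (m + m') i) =
      (\<Prod>i\<in>?S. x i ^ Poly_Mapping.lookup m i) * (\<Prod>i\<in>?S. x i ^ Poly_Mapping.lookup m' i)"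
    by (simp add: lookup_add power_add prod.distrib)
  then show ?thesis
    using eq[of "m + m'"] eq[of m] eq[of m'] Poly_Mapping.keys_add[of m m'] by simp
qed

text \<open>Updating at a fresh key is the addition of a \<open>single\<close>. Applied to each
  factor in turn, this reduces multiplicativity of evaluation to monomials.\<close>

lemma poly_mapping_add_induct [case_names single add]:
  assumes "\<And>k v. P (Poly_Mapping.single k v)" "\<And>f g. P f \<Longrightarrow> P g \<Longrightarrow> P (f + g)"
  shows "P f"
proof (induction f rule: update_induct)
  case const
  show ?case using assms(1)[of _ 0] by simp
next
  case (update f a b)
  have "Poly_Mapping.update a b f = f + Poly_Mapping.single a b"
    using update(1) by (intro poly_mapping_eqI)
      (auto simp: lookup_update lookup_add lookup_single in_keys_iff)
  then show ?case using assms update by metis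
qed

lemma poly_eval_single_mult:
  "poly_eval x (Poly_Mapping.single m c * Q) = poly_eval x (Poly_Mapping.single m c) * poly_eval x Q"
proof (induction Q rule: poly_mapping_add_induct)
  case (single k v)
  show ?case
    by (simp add: mult_single poly_eval_single monomial_eval_add of_rat_mult)
next
  case (add f g)
  then show ?case by (simp add: distrib_left poly_eval_add)
qed

lemma poly_eval_mult: "poly_eval x (P * Q) = poly_eval x P * poly_eval x Q"
proof (induction P rule: poly_mapping_add_induct)
  case (single k v)
  show ?case by (rule poly_eval_single_mult)
next
  case (add f g)
  then show ?case by (simp add: distrib_right poly_eval_add)
qed

text \<open>Genericity speaks of formal polynomials, but the quantities to be tested are functions
  of the coordinates. A predicate on functions with closure rules spares the construction of a
  polynomial for each of them.\<close>

definition rat_poly_fun :: "'i set \<Rightarrow> (('i \<Rightarrow> real) \<Rightarrow> real) \<Rightarrow> bool" where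
  "rat_poly_fun I f \<longleftrightarrow>
     (\<exists>P. (\<forall>m\<in>Poly_Mapping.keys P. Poly_Mapping.keys m \<subseteq> I) \<and> (\<forall>x. poly_eval x P = f x))"

lemma rat_poly_fun_of_rat: "rat_poly_fun I (\<lambda>x. of_rat c)"
  unfolding rat_poly_fun_def
  by (rule exI[of _ "Poly_Mapping.single 0 c"]) (auto simp: poly_eval_single)

lemma rat_poly_fun_var: "i \<in> I \<Longrightarrow> rat_poly_fun I (\<lambda>x. x i)"
  unfolding rat_poly_fun_def
  by (rule exI[of _ "Poly_Mapping.single (Poly_Mapping.single i 1) 1"])
    (auto simp: poly_eval_single)

lemma rat_poly_fun_add:
  assumes "rat_poly_fun I f" "rat_poly_fun I g"
  shows "rat_poly_fun I (\<lambda>x. f x + g x)"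
proof -
  from assms obtain P Q where
    "\<forall>m\<in>Poly_Mapping.keys P. Poly_Mapping.keys m \<subseteq> I" "\<And>x. poly_eval x P = f x"
    "\<forall>m\<in>Poly_Mapping.keys Q. Poly_Mapping.keys m \<subseteq> I" "\<And>x. poly_eval x Q = g x"
    unfolding rat_poly_fun_def by blast
  then show ?thesis unfolding rat_poly_fun_def
    using Poly_Mapping.keys_add[of P Q]
    by (intro exI[of _ "P + Q"]) (fastforce simp: poly_eval_add)
qed

lemma rat_poly_fun_mult:
  assumes "rat_poly_fun I f" "rat_poly_fun I g"
  shows "rat_poly_fun I (\<lambda>x. f x * g x)"
proof -
  from assms obtain P Q where
    P: "\<forall>m\<in>Poly_Mapping.keys P. Poly_Mapping.keys m \<subseteq> I" "\<And>x. poly_eval x P = f x" and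
    Q: "\<forall>m\<in>Poly_Mapping.keys Q. Poly_Mapping.keys m \<subseteq> I" "\<And>x. poly_eval x Q = g x"
    unfolding rat_poly_fun_def by blast
  have "Poly_Mapping.keys m \<subseteq> I" if "m \<in> Poly_Mapping.keys (P * Q)" for m
  proof -
    from that obtain a b where "a \<in> Poly_Mapping.keys P" "b \<in> Poly_Mapping.keys Q" "m = a + b"
      using keys_mult[of P Q] by blast
    then show ?thesis using P(1) Q(1) Poly_Mapping.keys_add[of a b] by blast
  qed
  then show ?thesis unfolding rat_poly_fun_def
    using P Q by (intro exI[of _ "P * Q"]) (auto simp: poly_eval_mult)
qed

lemma rat_poly_fun_numeral: "rat_poly_fun I (\<lambda>x. numeral k)"
  using rat_poly_fun_of_rat[of I "numeral k"] by simp

lemma rat_poly_fun_of_int: "rat_poly_fun I (\<lambda>x. of_int k)"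
  using rat_poly_fun_of_rat[of I "of_int k"] by simp

lemma rat_poly_fun_diff:
  assumes "rat_poly_fun I f" "rat_poly_fun I g"
  shows "rat_poly_fun I (\<lambda>x. f x - g x)"
  using rat_poly_fun_add[OF assms(1) rat_poly_fun_mult[OF rat_poly_fun_of_int[of I "-1"] assms(2)]]
  by simp

lemma rat_poly_fun_sum:
  assumes "\<And>a. a \<in> A \<Longrightarrow> rat_poly_fun I (f a)"
  shows "rat_poly_fun I (\<lambda>x. \<Sum>a\<in>A. f a x)"
  using assms rat_poly_fun_of_int[of I 0]
  by (induction A rule: infinite_finite_induct) (auto intro!: rat_poly_fun_add)

lemma rat_poly_fun_prod:
  assumes "\<And>a. a \<in> A \<Longrightarrow> rat_poly_fun I (f a)"
  shows "rat_poly_fun I (\<lambda>x. \<Prod>a\<in>A. f a x)"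
  using assms rat_poly_fun_of_int[of I 1]
  by (induction A rule: infinite_finite_induct) (auto intro!: rat_poly_fun_mult)

lemma rat_poly_fun_det:
  assumes "\<And>i j. i < n \<Longrightarrow> j < n \<Longrightarrow> rat_poly_fun I (\<lambda>x. A x i j)"
  shows "rat_poly_fun I (\<lambda>x. Determinant.det (Matrix.mat n n (\<lambda>(i, j). A x i j)))"
proof -
  have "Determinant.det (Matrix.mat n n (\<lambda>(i, j). A x i j)) =
      (\<Sum>p\<in>{p. p permutes {0..<n}}. of_int (sign p) * (\<Prod>i=0..<n. A x i (p i)))" for x
    by (subst det_def'[of _ n])
      (auto intro!: sum.cong prod.cong simp: permutes_in_image less_eq_iff_succ_less
        dest: permutes_in_image[where x = "_ :: nat"])
  moreover have "rat_poly_fun I (\<lambda>x. \<Sum>p\<in>{p. p permutes {0..<n}}. of_int (sign p) * (\<Prod>i=0..<n. A x i (p i)))"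
    using assms
    by (intro rat_poly_fun_sum rat_poly_fun_mult rat_poly_fun_of_int rat_poly_fun_prod)
      (auto dest: permutes_in_image)
  ultimately show ?thesis by simp
qed

text \<open>The value at \<open>y\<close> shows that the representing polynomial is not zero, so it
  cannot vanish at the algebraically independent \<open>x\<close>. The point \<open>y\<close> itself
  may be as special as desired.\<close>

lemma rat_poly_fun_nonzero:
  assumes "algebraically_independent_over_rat I x" "rat_poly_fun I f" "f y \<noteq> 0"
  shows "f x \<noteq> 0"
proof -
  obtain P where P: "\<forall>m\<in>Poly_Mapping.keys P. Poly_Mapping.keys m \<subseteq> I" "\<And>x. poly_eval x P = f x"
    using assms(2) unfolding rat_poly_fun_def by blast
  have "P \<noteq> 0" using assms(3) P(2)[of y] by (auto simp: poly_eval_def)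
  then show ?thesis using assms(1) P unfolding algebraically_independent_over_rat_def by metis
qed

no_notation Matrix.scalar_prod (infix "\<bullet>" 70)

section \<open>Stresses\<close>

text \<open>For an edge \<open>e = {v, w}\<close> the value at \<open>v\<close> is \<open>p v - p w\<close>.\<close>

definition rigidity_row :: "('a \<Rightarrow> real ^ 2) \<Rightarrow> 'a set \<Rightarrow> 'a \<Rightarrow> real ^ 2" where
  "rigidity_row p e v = (if v \<in> e then 2 *\<^sub>R p v - (\<Sum>w\<in>e. p w) else 0)"

text \<open>The rows of the rigidity matrix that belong to \<open>F\<close> are linearly
  independent: zero is the only equilibrium stress.\<close>

definition stress_free :: "'a set set \<Rightarrow> ('a \<Rightarrow> real ^ 2) \<Rightarrow> bool" where
  "stress_free F p \<longleftrightarrow>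
     (\<forall>\<omega>. (\<forall>v. (\<Sum>e\<in>F. \<omega> e *\<^sub>R rigidity_row p e v) = 0) \<longrightarrow> (\<forall>e\<in>F. \<omega> e = 0))"

text \<open>An entry of the product of the rigidity matrix with its transpose. The rigidity matrix
  need not be square, and this determinant detects independence of its rows without the choice of a
  minor.\<close>

definition gram :: "'a set \<Rightarrow> ('a \<Rightarrow> real ^ 2) \<Rightarrow> 'a set \<Rightarrow> 'a set \<Rightarrow> real" where
  "gram W p e f = (\<Sum>v\<in>W. rigidity_row p e v \<bullet> rigidity_row p f v)"

definition gram_det :: "'a set \<Rightarrow> 'a set list \<Rightarrow> ('a \<Rightarrow> real ^ 2) \<Rightarrow> real" where
  "gram_det W es p = Determinant.det (Matrix.mat (length es) (length es)
     (\<lambda>(i, j). gram W p (es ! i) (es ! j)))"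

lemma rigidity_row_pair:
  assumes "u \<noteq> v"
  shows "rigidity_row p {u, v} u = p u - p v" "rigidity_row p {u, v} v = p v - p u"
    "w \<notin> {u, v} \<Longrightarrow> rigidity_row p {u, v} w = 0"
  using assms by (auto simp: rigidity_row_def scaleR_2)

text \<open>Over the reals the Gram matrix has the stresses as its kernel: pairing its value at
  \<omega> with \<omega> gives the sum over the vertices of the squared norms of the resulting
  forces \<open>S \<omega> v\<close>, so all these forces vanish.\<close>

lemma stress_free_iff_gram_det:
  assumes W: "finite W" "F \<subseteq> Pow W" and es: "distinct es" "set es = F"
  shows "stress_free F p \<longleftrightarrow> gram_det W es p \<noteq> 0"
proof -
  define n where "n = length es"
  define A where "A = Matrix.mat n n (\<lambda>(i, j). gram W p (es ! i) (es ! j))"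
  define S where "S \<omega> v = (\<Sum>e\<in>F. \<omega> e *\<^sub>R rigidity_row p e v)" for \<omega> v
  have A: "A \<in> carrier_mat n n" by (simp add: A_def)
  have bij: "bij_betw (\<lambda>i. es ! i) {0..<n} F"
    using bij_betw_nth[OF es(1) refl refl] es(2) by (simp add: n_def lessThan_atLeast0)
  have row: "vec_index (mult_mat_vec A (Matrix.vec n (\<lambda>i. \<omega> (es ! i)))) i =
      (\<Sum>v\<in>W. rigidity_row p (es ! i) v \<bullet> S \<omega> v)" if i: "i < n" for \<omega> i
  proof -
    have "vec_index (mult_mat_vec A (Matrix.vec n (\<lambda>i. \<omega> (es ! i)))) i =
        (\<Sum>j\<in>{0..<n}. gram W p (es ! i) (es ! j) * \<omega> (es ! j))"
      using i by (simp add: A_def scalar_prod_def)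
    also have "\<dots> = (\<Sum>f\<in>F. gram W p (es ! i) f * \<omega> f)"
      by (rule sum.reindex_bij_betw[OF bij])
    also have "\<dots> = (\<Sum>f\<in>F. \<Sum>v\<in>W. rigidity_row p (es ! i) v \<bullet> (\<omega> f *\<^sub>R rigidity_row p f v))"
      by (simp add: gram_def sum_distrib_left mult.commute)
    also have "\<dots> = (\<Sum>v\<in>W. rigidity_row p (es ! i) v \<bullet> S \<omega> v)"
      by (subst sum.swap) (simp add: S_def inner_sum_right)
    finally show ?thesis .
  qed
  have ker: "mult_mat_vec A (Matrix.vec n (\<lambda>i. \<omega> (es ! i))) = 0\<^sub>v n \<longleftrightarrow> (\<forall>v. S \<omega> v = 0)" for \<omega>
  proof
    assume 0: "mult_mat_vec A (Matrix.vec n (\<lambda>i. \<omega> (es ! i))) = 0\<^sub>v n"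
    have "(\<Sum>v\<in>W. rigidity_row p (es ! i) v \<bullet> S \<omega> v) = 0" if "i < n" for i
      using row[OF that, of \<omega>] that unfolding 0 by simp
    then have "(\<Sum>v\<in>W. rigidity_row p e v \<bullet> S \<omega> v) = 0" if "e \<in> F" for e
      using that bij by (auto simp: bij_betw_def)
    then have "0 = (\<Sum>e\<in>F. \<omega> e * (\<Sum>v\<in>W. rigidity_row p e v \<bullet> S \<omega> v))"
      by simp
    also have "\<dots> = (\<Sum>v\<in>W. S \<omega> v \<bullet> S \<omega> v)"
      unfolding sum_distrib_left
      by (subst sum.swap) (simp add: S_def inner_sum_left)
    finally have "\<forall>v\<in>W. S \<omega> v = 0"
      using W(1) by (subst (asm) eq_commute, subst (asm) sum_nonneg_eq_0_iff) auto
    moreover have "S \<omega> v = 0" if "v \<notin> W" for v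
      using that W(2) unfolding S_def by (intro sum.neutral) (auto simp: rigidity_row_def)
    ultimately show "\<forall>v. S \<omega> v = 0" by blast
  next
    assume "\<forall>v. S \<omega> v = 0"
    then show "mult_mat_vec A (Matrix.vec n (\<lambda>i. \<omega> (es ! i))) = 0\<^sub>v n"
      using A row[of _ \<omega>] by (intro eq_vecI) auto
  qed
  have nz: "Matrix.vec n (\<lambda>i. \<omega> (es ! i)) = 0\<^sub>v n \<longleftrightarrow> (\<forall>e\<in>F. \<omega> e = 0)" for \<omega> :: "'a set \<Rightarrow> real"
    using bij by (auto simp: Matrix.vec_eq_iff bij_betw_def)
  have ex: "\<exists>\<omega>. y = Matrix.vec n (\<lambda>i. \<omega> (es ! i))" if "y \<in> carrier_vec n" for y :: "real Matrix.vec"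
  proof
    show "y = Matrix.vec n (\<lambda>i. (\<lambda>e. vec_index y (the_inv_into {0..<n} (\<lambda>i. es ! i) e)) (es ! i))"
      using that bij by (auto simp: Matrix.vec_eq_iff bij_betw_def the_inv_into_f_f)
  qed
  have "gram_det W es p = 0 \<longleftrightarrow> (\<exists>y\<in>carrier_vec n. y \<noteq> 0\<^sub>v n \<and> mult_mat_vec A y = 0\<^sub>v n)"
    using det_0_iff_vec_prod_zero[OF A] by (auto simp: gram_det_def A_def n_def)
  also have "\<dots> \<longleftrightarrow> (\<exists>\<omega>. \<not> (\<forall>e\<in>F. \<omega> e = 0) \<and> (\<forall>v. S \<omega> v = 0))"
  proof
    assume "\<exists>y\<in>carrier_vec n. y \<noteq> 0\<^sub>v n \<and> mult_mat_vec A y = 0\<^sub>v n"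
    then obtain y where y: "y \<in> carrier_vec n" "y \<noteq> 0\<^sub>v n" "mult_mat_vec A y = 0\<^sub>v n" by blast
    obtain \<omega> where "y = Matrix.vec n (\<lambda>i. \<omega> (es ! i))" using ex[OF y(1)] by blast
    then show "\<exists>\<omega>. \<not> (\<forall>e\<in>F. \<omega> e = 0) \<and> (\<forall>v. S \<omega> v = 0)" using ker nz y by blast
  next
    assume "\<exists>\<omega>. \<not> (\<forall>e\<in>F. \<omega> e = 0) \<and> (\<forall>v. S \<omega> v = 0)"
    then obtain \<omega> where "\<not> (\<forall>e\<in>F. \<omega> e = 0)" "\<forall>v. S \<omega> v = 0" by blast
    then show "\<exists>y\<in>carrier_vec n. y \<noteq> 0\<^sub>v n \<and> mult_mat_vec A y = 0\<^sub>v n"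
      using ker[of \<omega>] nz[of \<omega>] by (intro bexI[of _ "Matrix.vec n (\<lambda>i. \<omega> (es ! i))"]) auto
  qed
  also have "\<dots> \<longleftrightarrow> \<not> stress_free F p"
    by (auto simp: stress_free_def S_def)
  finally show ?thesis by blast
qed

lemma rat_poly_fun_gram_det:
  assumes "\<Union> (set es) \<subseteq> V" "finite V"
  shows "rat_poly_fun (V \<times> UNIV) (\<lambda>x. gram_det V es (\<lambda>v. \<chi> c. x (v, c)))"
proof -
  have row: "rat_poly_fun (V \<times> UNIV) (\<lambda>x. vec_nth (rigidity_row (\<lambda>v. \<chi> c. x (v, c)) e v) c)"
    if "e \<in> set es" for e v and c :: 2
  proof (cases "v \<in> e")
    case True
    then show ?thesis using that assms(1)
      by (auto simp: rigidity_row_def intro!: rat_poly_fun_diff rat_poly_fun_mult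
          rat_poly_fun_numeral rat_poly_fun_var rat_poly_fun_sum)
  next
    case False
    then show ?thesis using rat_poly_fun_of_int[of _ 0] by (simp add: rigidity_row_def)
  qed
  show ?thesis
    unfolding gram_det_def gram_def inner_vec_def inner_real_def
    by (intro rat_poly_fun_det rat_poly_fun_sum rat_poly_fun_mult row) auto
qed

section \<open>From special to generic placements\<close>

lemma generic_framework_nonzero:
  assumes "generic_framework G p" "rat_poly_fun (pverts G \<times> UNIV) (\<lambda>x. f (\<lambda>v. \<chi> c. x (v, c)))"
    and "f q \<noteq> 0"
  shows "f p \<noteq> 0"
proof -
  have eq: "(\<lambda>v. \<chi> c. (case (v, c) of (v, c) \<Rightarrow> vec_nth (r v) c)) = r" for r :: "'a \<Rightarrow> real ^ 2"
    by simp
  show ?thesis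
    using rat_poly_fun_nonzero[OF _ assms(2), of "\<lambda>(v, c). vec_nth (p v) c" "\<lambda>(v, c). vec_nth (q v) c"]
      assms(1,3) by (simp add: generic_framework_def)
qed

text \<open>The Gram determinant of \<open>F\<close> is a rational polynomial in the coordinates,
  and \<open>q\<close> witnesses that it is not the zero polynomial. Independence may therefore be
  proved in a degenerate position.\<close>

lemma stress_free_generic:
  assumes "generic_framework G p" "finite (pverts G)" "F \<subseteq> Pow (pverts G)" "stress_free F q"
  shows "stress_free F p"
proof -
  have "finite F" using assms(2,3) finite_subset by blast
  then obtain es where es: "distinct es" "set es = F" using finite_distinct_list by metis
  note iff = stress_free_iff_gram_det[OF assms(2,3) es]
  show ?thesis
    unfolding iff using assms(3,4) es
    by (intro generic_framework_nonzero[OF assms(1) rat_poly_fun_gram_det[OF _ assms(2)]])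
      (auto simp: iff)
qed

definition cross :: "real ^ 2 \<Rightarrow> real ^ 2 \<Rightarrow> real" where
  "cross x y = vec_nth x 1 * vec_nth y 2 - vec_nth x 2 * vec_nth y 1"

text \<open>Cramer's rule for two equations.\<close>

lemma cross_zero_combination:
  assumes "a *\<^sub>R x + b *\<^sub>R y = 0" "cross x y \<noteq> 0"
  shows "a = 0" "b = 0"
proof -
  have *: "a * vec_nth x i + b * vec_nth y i = 0" for i
    using arg_cong[OF assms(1), of "\<lambda>z. vec_nth z i"] by simp
  have "a * cross x y = (a * vec_nth x 1 + b * vec_nth y 1) * vec_nth y 2
      - (a * vec_nth x 2 + b * vec_nth y 2) * vec_nth y 1"
    "b * cross x y = (a * vec_nth x 2 + b * vec_nth y 2) * vec_nth x 1
      - (a * vec_nth x 1 + b * vec_nth y 1) * vec_nth x 2"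
    unfolding cross_def by (simp_all add: algebra_simps)
  then have "a * cross x y = 0" "b * cross x y = 0"
    by (simp_all only: * mult_zero_left diff_self)
  then show "a = 0" "b = 0" using assms(2) by auto
qed

lemma generic_not_collinear:
  assumes "generic_framework G p" "{a, b, c} \<subseteq> pverts G" "card {a, b, c} = 3"
  shows "cross (p b - p a) (p c - p a) \<noteq> 0"
proof -
  have ne: "a \<noteq> b" "a \<noteq> c" "b \<noteq> c" using assms(3) by (auto simp: card_insert_if split: if_splits)
  \<comment> \<open>A right triangle with \<open>a\<close> at the origin and unit legs, for which
    the determinant is 1.\<close>
  define q :: "'a \<Rightarrow> real ^ 2" where
    "q v = (if v = b then axis 1 1 else if v = c then axis 2 1 else 0)" for v
  show ?thesis
    by (rule generic_framework_nonzero[OF assms(1), where q = q])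
      (use ne assms(2) in \<open>auto simp: cross_def q_def axis_def intro!: rat_poly_fun_diff
          rat_poly_fun_mult rat_poly_fun_var\<close>)
qed

lemma generic_inj:
  assumes "generic_framework G p" "{a, b} \<subseteq> pverts G" "a \<noteq> b"
  shows "p a \<noteq> p b"
proof -
  define q :: "'a \<Rightarrow> real ^ 2" where "q v = (if v = b then axis 1 1 else 0)" for v
  have "vec_nth (p b) 1 - vec_nth (p a) 1 \<noteq> 0"
    by (rule generic_framework_nonzero[OF assms(1), where q = q])
      (use assms(2,3) in \<open>auto simp: q_def axis_def intro!: rat_poly_fun_diff rat_poly_fun_var\<close>)
  then show ?thesis by auto
qed

section \<open>Laman's theorem\<close>

text \<open>\<open>X\<close> ranges over all finite sets, so no vertex set is carried along; adding
  3 on the left avoids truncated subtraction.\<close>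

definition laman_sparse :: "'a set set \<Rightarrow> bool" where
  "laman_sparse F \<longleftrightarrow> (\<forall>X. finite X \<longrightarrow> 2 \<le> card X \<longrightarrow> card (F \<inter> Pow X) + 3 \<le> 2 * card X)"

definition tight :: "'a set set \<Rightarrow> 'a set \<Rightarrow> bool" where
  "tight F X \<longleftrightarrow> finite X \<and> 2 \<le> card X \<and> card (F \<inter> Pow X) + 3 = 2 * card X"

lemma sparse_mono:
  assumes "laman_sparse F" "F' \<subseteq> F" "finite F"
  shows "laman_sparse F'"
  unfolding laman_sparse_def
proof (intro allI impI)
  fix X :: "'a set" assume "finite X" "2 \<le> card X"
  moreover have "card (F' \<inter> Pow X) \<le> card (F \<inter> Pow X)"
    using assms by (intro card_mono) auto
  moreover have "card (F \<inter> Pow X) + 3 \<le> 2 * card X"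
    using assms(1) calculation unfolding laman_sparse_def by blast
  ultimately show "card (F' \<inter> Pow X) + 3 \<le> 2 * card X"
    by linarith
qed

text \<open>Dropping the elements of \<open>X\<close> outside \<open>\<Union>F\<close> loses no
  edge, so the smaller set would violate sparsity. It still has two elements because
  \<open>X\<close> contains an edge: the number 2 * card X - 3 is odd, hence not 0.\<close>

lemma tight_subset_Union:
  assumes "laman_sparse F" "tight F X" "\<And>e. e \<in> F \<Longrightarrow> card e = 2"
  shows "X \<subseteq> \<Union>F"
proof -
  let ?Y = "X \<inter> \<Union>F"
  have X: "finite X" "2 \<le> card X" "card (F \<inter> Pow X) + 3 = 2 * card X"
    using assms(2) by (auto simp: tight_def)
  have eq: "F \<inter> Pow ?Y = F \<inter> Pow X" by auto
  have "F \<inter> Pow X \<noteq> {}"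
  proof
    assume "F \<inter> Pow X = {}"
    then have "3 = 2 * card X" using X(3) by simp
    then show False by presburger
  qed
  then obtain e where e: "e \<in> F" "e \<subseteq> X" by blast
  then have "card e \<le> card ?Y" using X(1) by (intro card_mono) auto
  then have "2 \<le> card ?Y" using assms(3)[OF e(1)] by simp
  then have "card (F \<inter> Pow ?Y) + 3 \<le> 2 * card ?Y"
    using assms(1) X(1) finite_Int[of X "\<Union>F"] unfolding laman_sparse_def by blast
  then have "card X \<le> card ?Y" unfolding eq using X by linarith
  then have "?Y = X" using X(1) by (intro card_seteq) auto
  then show ?thesis by blast
qed

text \<open>The number of edges inside a set is supermodular and 2 * card X - 3 is modular. Equality
  at \<open>X\<close> and \<open>Y\<close> with the sparsity bound at union and intersection forces
  equality at the union; the bound holds at the intersection because it has two elements.\<close>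

lemma tight_Un:
  assumes "laman_sparse F" "finite F" "tight F X" "tight F Y" "2 \<le> card (X \<inter> Y)"
  shows "tight F (X \<union> Y)"
proof -
  have X: "finite X" "card (F \<inter> Pow X) + 3 = 2 * card X" "2 \<le> card X"
    and Y: "finite Y" "card (F \<inter> Pow Y) + 3 = 2 * card Y"
    using assms(3,4) by (auto simp: tight_def)
  have "card (F \<inter> Pow X) + card (F \<inter> Pow Y) =
      card ((F \<inter> Pow X) \<union> (F \<inter> Pow Y)) + card ((F \<inter> Pow X) \<inter> (F \<inter> Pow Y))"
    using assms(2) by (intro card_Un_Int) auto
  also have "(F \<inter> Pow X) \<inter> (F \<inter> Pow Y) = F \<inter> Pow (X \<inter> Y)" by auto
  also have "card ((F \<inter> Pow X) \<union> (F \<inter> Pow Y)) \<le> card (F \<inter> Pow (X \<union> Y))"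
    using assms(2) by (intro card_mono) auto
  finally have 1: "card (F \<inter> Pow X) + card (F \<inter> Pow Y) \<le>
      card (F \<inter> Pow (X \<union> Y)) + card (F \<inter> Pow (X \<inter> Y))" by simp
  have 2: "card X + card Y = card (X \<union> Y) + card (X \<inter> Y)"
    using X Y by (intro card_Un_Int)
  have "card X \<le> card (X \<union> Y)" using X Y by (intro card_mono) auto
  then have "2 \<le> card (X \<union> Y)" using X by simp
  moreover from this have "card (F \<inter> Pow (X \<union> Y)) + 3 \<le> 2 * card (X \<union> Y)"
    using assms(1) X Y unfolding laman_sparse_def by blast
  moreover have "card (F \<inter> Pow (X \<inter> Y)) + 3 \<le> 2 * card (X \<inter> Y)"
    using assms(1,5) X Y unfolding laman_sparse_def by blast
  ultimately show ?thesis using 1 2 X Y unfolding tight_def by auto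
qed

lemma card_Int_le_1:
  assumes "finite X" "a \<in> X \<inter> Y" "\<not> 2 \<le> card (X \<inter> Y)"
  shows "X \<inter> Y = {a}"
proof -
  have "card (X \<inter> Y) > 0" using assms by (auto simp: card_gt_0_iff)
  then have "card (X \<inter> Y) = 1" using assms(3) by linarith
  then obtain x where "X \<inter> Y = {x}" by (auto simp: card_1_singleton_iff)
  then show ?thesis using assms(2) by simp
qed

text \<open>If two of the sets share two elements, their union is tight and already contains all
  three points. Otherwise the sets meet in single points, no edge lies in two of them, and the union
  T has card T + 3 elements counted with multiplicity, so it contains 2 * (card T + 3) - 9 = 2 *
  card T - 3 edges.\<close>

lemma tight_triangle:
  assumes F: "laman_sparse F" "finite F" "\<And>e. e \<in> F \<Longrightarrow> card e = 2"
    and t: "tight F X" "tight F Y" "tight F Z"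
    and abc: "a \<in> Y \<inter> Z" "b \<in> X \<inter> Z" "c \<in> X \<inter> Y" "a \<noteq> b" "a \<noteq> c" "b \<noteq> c"
  shows "\<exists>T. tight F T \<and> {a, b, c} \<subseteq> T"
proof -
  have X: "finite X" "card (F \<inter> Pow X) + 3 = 2 * card X" "2 \<le> card X"
    and Y: "finite Y" "card (F \<inter> Pow Y) + 3 = 2 * card Y"
    and Z: "finite Z" "card (F \<inter> Pow Z) + 3 = 2 * card Z"
    using t by (auto simp: tight_def)
  consider "2 \<le> card (X \<inter> Y)" | "2 \<le> card (X \<inter> Z)" | "2 \<le> card (Y \<inter> Z)" |
    "X \<inter> Y = {c}" "X \<inter> Z = {b}" "Y \<inter> Z = {a}"
    using card_Int_le_1[OF X(1) abc(3)] card_Int_le_1[OF X(1) abc(2)] card_Int_le_1[OF Y(1) abc(1)]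
    by blast
  then show ?thesis
  proof cases
    case 1
    then show ?thesis using tight_Un[OF F(1,2) t(1,2)] abc by blast
  next
    case 2
    then show ?thesis using tight_Un[OF F(1,2) t(1,3)] abc by blast
  next
    case 3
    then show ?thesis using tight_Un[OF F(1,2) t(2,3)] abc by blast
  next
    case 4
    let ?T = "X \<union> Y \<union> Z"
    have "(X \<union> Y) \<inter> Z = {a, b}" using 4 by blast
    then have "card ?T + 2 = card (X \<union> Y) + card Z"
      using card_Un_Int[of "X \<union> Y" Z] X(1) Y(1) Z(1) abc(4) by simp
    moreover have "card (X \<union> Y) + 1 = card X + card Y"
      using card_Un_Int[of X Y] X(1) Y(1) 4(1) by simp
    ultimately have cT: "card ?T + 3 = card X + card Y + card Z" by simp
    have small: "F \<inter> Pow A \<inter> (F \<inter> Pow B) = {}" if "A \<inter> B = {d}" for A B d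
    proof (rule ccontr)
      assume "F \<inter> Pow A \<inter> (F \<inter> Pow B) \<noteq> {}"
      then obtain e where e: "e \<in> F" "e \<subseteq> A" "e \<subseteq> B" by blast
      then have "e \<subseteq> {d}" using that by (metis Int_greatest)
      then have "card e \<le> 1" using card_mono[of "{d}" e] by simp
      then show False using F(3)[OF e(1)] by simp
    qed
    have "card (F \<inter> Pow X \<union> F \<inter> Pow Y \<union> F \<inter> Pow Z) =
        card (F \<inter> Pow X) + card (F \<inter> Pow Y) + card (F \<inter> Pow Z)"
      using F(2) small[OF 4(1)] small[OF 4(2)] small[OF 4(3)]
      by (simp add: card_Un_disjoint Int_Un_distrib2)
    moreover have "card (F \<inter> Pow X \<union> F \<inter> Pow Y \<union> F \<inter> Pow Z) \<le> card (F \<inter> Pow ?T)"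
      using F(2) by (intro card_mono) auto
    moreover have "card X \<le> card ?T"
      using X(1) Y(1) Z(1) by (intro card_mono) auto
    then have T: "finite ?T" "2 \<le> card ?T"
      using X(1,3) Y(1) Z(1) by auto
    moreover have "card (F \<inter> Pow ?T) + 3 \<le> 2 * card ?T"
      using F(1)[unfolded laman_sparse_def, rule_format, OF T] .
    ultimately have "card (F \<inter> Pow ?T) + 3 = 2 * card ?T"
      using cT X(2) Y(2) Z(2) by linarith
    then have "tight F ?T"
      using T unfolding tight_def by blast
    then show ?thesis using abc by blast
  qed
qed

text \<open>A pair that already belongs to \<open>F\<close> is itself tight, as 2 * 2 - 3 = 1.
  Otherwise insertion adds one edge to a violated set, which must have been tight before and contain
  \<open>e\<close>.\<close>

lemma not_sparse_insert:
  assumes "laman_sparse F" "finite F" "\<not> (laman_sparse (insert e F) \<and> e \<notin> F)" "card e = 2"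
  shows "\<exists>T. tight F T \<and> e \<subseteq> T"
proof (cases "e \<in> F")
  case True
  have fe: "finite e" using assms(4) by (metis card.infinite zero_neq_numeral)
  have "0 < card (F \<inter> Pow e)" using True assms(2) by (auto simp: card_gt_0_iff)
  moreover have "card (F \<inter> Pow e) + 3 \<le> 2 * card e"
    using assms(1,4) fe unfolding laman_sparse_def by auto
  ultimately have "tight F e" using fe assms(4) by (auto simp: tight_def)
  then show ?thesis by blast
next
  case False
  then obtain X where X: "finite X" "2 \<le> card X" "\<not> card (insert e F \<inter> Pow X) + 3 \<le> 2 * card X"
    using assms(3) unfolding laman_sparse_def by blast
  have le: "card (F \<inter> Pow X) + 3 \<le> 2 * card X" using assms(1) X unfolding laman_sparse_def by blast
  have "e \<subseteq> X"
  proof (rule ccontr)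
    assume "\<not> e \<subseteq> X"
    then have "insert e F \<inter> Pow X = F \<inter> Pow X" by auto
    then show False using X(3) le by simp
  qed
  moreover from this have "insert e F \<inter> Pow X = insert e (F \<inter> Pow X)" by auto
  then have "card (insert e F \<inter> Pow X) \<le> Suc (card (F \<inter> Pow X))"
    by (simp add: card_insert_le_m1 card_insert_if assms(2))
  then have "tight F X" using X le by (auto simp: tight_def)
  ultimately show ?thesis by blast
qed

text \<open>Sparsity keeps the degree sum at most 4 * card W - 6 for the set W of covered vertices,
  so the average degree is below 4.\<close>

lemma exists_low_degree:
  assumes F: "laman_sparse F" "finite F" "F \<noteq> {}" "\<And>e. e \<in> F \<Longrightarrow> card e = 2"
  shows "\<exists>v. 1 \<le> card {e \<in> F. v \<in> e} \<and> card {e \<in> F. v \<in> e} \<le> 3"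
proof (rule ccontr)
  assume neg: "\<not> ?thesis"
  let ?W = "\<Union>F"
  have fin_e: "finite e" if "e \<in> F" for e
    using F(4)[OF that] by (metis card.infinite zero_neq_numeral)
  then have W: "finite ?W" using F(2) by blast
  have "4 \<le> card {e \<in> F. v \<in> e}" if "v \<in> ?W" for v
  proof -
    have "0 < card {e \<in> F. v \<in> e}" using that F(2) by (auto simp: card_gt_0_iff)
    moreover have "\<not> (1 \<le> card {e \<in> F. v \<in> e} \<and> card {e \<in> F. v \<in> e} \<le> 3)" using neg by blast
    ultimately show ?thesis by linarith
  qed
  then have "4 * card ?W \<le> (\<Sum>v\<in>?W. card {e \<in> F. v \<in> e})"
    using sum_mono[of ?W "\<lambda>_. 4" "\<lambda>v. card {e \<in> F. v \<in> e}"] by simp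
  also have "\<dots> = (\<Sum>e\<in>F. card {v \<in> ?W. v \<in> e})"
    using sum.swap_restrict[OF W F(2), of "\<lambda>_ _. 1 :: nat" "\<lambda>v e. v \<in> e"] by simp
  also have "\<dots> = (\<Sum>e\<in>F. 2)"
  proof (intro sum.cong refl)
    fix e assume "e \<in> F"
    then have "{v \<in> ?W. v \<in> e} = e" by auto
    then show "card {v \<in> ?W. v \<in> e} = 2" using F(4) \<open>e \<in> F\<close> by simp
  qed
  finally have "2 * card ?W \<le> card F" by simp
  moreover have "F \<inter> Pow ?W = F" by auto
  moreover obtain e where e: "e \<in> F" using F(3) by blast
  then have "2 \<le> card ?W" using card_mono[OF W, of e] F(4) by auto
  then have "card (F \<inter> Pow ?W) + 3 \<le> 2 * card ?W" using F(1) W unfolding laman_sparse_def by blast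
  ultimately show False by simp
qed

section \<open>Henneberg moves\<close>

text \<open>Only edges at \<open>v\<close> exert a force there, so equilibrium at \<open>v\<close>
  kills their coefficients and leaves a stress on the other edges.\<close>

lemma stress_free_add_vertex:
  assumes F: "finite F" and F0: "stress_free {e \<in> F. v \<notin> e} p"
    and v: "\<And>\<omega>. (\<Sum>e | e \<in> F \<and> v \<in> e. \<omega> e *\<^sub>R rigidity_row p e v) = 0 \<Longrightarrow>
      \<forall>e\<in>F. v \<in> e \<longrightarrow> \<omega> e = 0"
  shows "stress_free F p"
  unfolding stress_free_def
proof (intro allI impI)
  fix \<omega> assume \<omega>: "\<forall>w. (\<Sum>e\<in>F. \<omega> e *\<^sub>R rigidity_row p e w) = 0"
  have "(\<Sum>e | e \<in> F \<and> v \<in> e. \<omega> e *\<^sub>R rigidity_row p e v) =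
      (\<Sum>e\<in>F. \<omega> e *\<^sub>R rigidity_row p e v)"
    using F by (intro sum.mono_neutral_left) (auto simp: rigidity_row_def)
  then have 0: "\<forall>e\<in>F. v \<in> e \<longrightarrow> \<omega> e = 0" using v \<omega> by simp
  have "(\<Sum>e\<in>{e \<in> F. v \<notin> e}. \<omega> e *\<^sub>R rigidity_row p e w) =
      (\<Sum>e\<in>F. \<omega> e *\<^sub>R rigidity_row p e w)" for w
    using F 0 by (intro sum.mono_neutral_left) auto
  then have "\<forall>e\<in>{e \<in> F. v \<notin> e}. \<omega> e = 0"
    using F0 \<omega> unfolding stress_free_def by presburger
  then show "\<forall>e\<in>F. \<omega> e = 0" using 0 by blast
qed

text \<open>With \<open>v\<close> at the midpoint of \<open>a\<close> and \<open>b\<close>, the edge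
  to \<open>c\<close> is the only one at \<open>v\<close> off the line \<open>a b\<close>; it
  carries no stress, and the edges to \<open>a\<close> and \<open>b\<close> carry equal stress.
  Together these two act like one stressed edge \<open>{a, b}\<close>, so a stress after the move
  yields one before it.\<close>

lemma stress_free_split_edge:
  assumes F0: "finite F0" "{a, b} \<notin> F0" "v \<notin> \<Union>F0"
    and ne: "a \<noteq> b" "a \<noteq> c" "b \<noteq> c" "v \<noteq> a" "v \<noteq> b" "v \<noteq> c"
    and sf: "stress_free (insert {a, b} F0) q"
    and cross: "cross (q b - q a) (q c - q a) \<noteq> 0"
  shows "stress_free (insert {v, a} (insert {v, b} (insert {v, c} F0)))
    (q(v := (1/2) *\<^sub>R (q a + q b)))"
  unfolding stress_free_def
proof (intro allI impI)
  let ?q = "q(v := (1/2) *\<^sub>R (q a + q b))"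
  let ?F = "insert {v, a} (insert {v, b} (insert {v, c} F0))"
  fix \<omega> assume "\<forall>w. (\<Sum>e\<in>?F. \<omega> e *\<^sub>R rigidity_row ?q e w) = 0"
  moreover have "{v, a} \<notin> F0" "{v, b} \<notin> F0" "{v, c} \<notin> F0"
    "{v, a} \<noteq> {v, b}" "{v, a} \<noteq> {v, c}" "{v, b} \<noteq> {v, c}"
    using F0(3) ne by (auto simp: doubleton_eq_iff)
  ultimately have \<omega>: "\<omega> {v, a} *\<^sub>R rigidity_row ?q {v, a} w + \<omega> {v, b} *\<^sub>R rigidity_row ?q {v, b} w +
      \<omega> {v, c} *\<^sub>R rigidity_row ?q {v, c} w + (\<Sum>e\<in>F0. \<omega> e *\<^sub>R rigidity_row ?q e w) = 0" for w
    using F0(1) by (simp add: add.assoc)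
  have v0: "(\<Sum>e\<in>F0. \<omega> e *\<^sub>R rigidity_row r e v) = 0" for r
    using F0(3) by (intro sum.neutral) (auto simp: rigidity_row_def)
  have row: "rigidity_row ?q e w = rigidity_row q e w" if "e \<in> F0" for e w
  proof -
    have "v \<notin> e" using that F0(3) by blast
    then have "(\<Sum>x\<in>e. ?q x) = (\<Sum>x\<in>e. q x)" by (intro sum.cong) auto
    then show ?thesis using \<open>v \<notin> e\<close> by (auto simp: rigidity_row_def)
  qed
  \<comment> \<open>The equilibrium at \<open>v\<close>, expanded in the basis
    \<open>q b - q a\<close>, \<open>q c - q a\<close>.\<close>
  have "((\<omega> {v, a} - \<omega> {v, b} + \<omega> {v, c}) / 2) *\<^sub>R (q b - q a) + (- \<omega> {v, c}) *\<^sub>R (q c - q a) =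
    \<omega> {v, a} *\<^sub>R (?q v - ?q a) + \<omega> {v, b} *\<^sub>R (?q v - ?q b) + \<omega> {v, c} *\<^sub>R (?q v - ?q c)"
    using ne by (simp add: Finite_Cartesian_Product.vec_eq_iff field_simps)
  also have "\<dots> = 0" using \<omega>[of v] ne by (simp add: rigidity_row_pair v0 del: fun_upd_apply)
  finally have "(\<omega> {v, a} - \<omega> {v, b} + \<omega> {v, c}) / 2 = 0" "- \<omega> {v, c} = 0"
    using cross_zero_combination[OF _ cross] by blast+
  then have c: "\<omega> {v, c} = 0" and ab: "\<omega> {v, b} = \<omega> {v, a}" by auto
  \<comment> \<open>The row of \<open>{v, a}\<close> at \<open>a\<close> is half the row of
    \<open>{a, b}\<close> there, because \<open>v\<close> is the midpoint; hence the factor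
    1/2.\<close>
  define \<omega>' where "\<omega>' e = (if e = {a, b} then \<omega> {v, a} / 2 else \<omega> e)" for e
  have "(\<Sum>e\<in>insert {a, b} F0. \<omega>' e *\<^sub>R rigidity_row q e w) = 0" for w
  proof -
    have "(\<Sum>e\<in>insert {a, b} F0. \<omega>' e *\<^sub>R rigidity_row q e w) =
        (\<omega> {v, a} / 2) *\<^sub>R rigidity_row q {a, b} w + (\<Sum>e\<in>F0. \<omega> e *\<^sub>R rigidity_row q e w)"
      using F0 by (auto simp: \<omega>'_def intro!: sum.cong)
    also have "(\<Sum>e\<in>F0. \<omega> e *\<^sub>R rigidity_row q e w) = (\<Sum>e\<in>F0. \<omega> e *\<^sub>R rigidity_row ?q e w)"
      by (intro sum.cong) (auto simp: row)
    also have "(\<omega> {v, a} / 2) *\<^sub>R rigidity_row q {a, b} w + \<dots> = 0"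
    proof -
      consider "w = v" | "w = a" | "w = b" | "w \<notin> {v, a, b}" by blast
      then show ?thesis
      proof cases
        case 1
        then show ?thesis using ne v0[of ?q] by (simp add: rigidity_row_pair)
      next
        case 2
        then show ?thesis using \<omega>[of a] ne c ab
          by (simp add: rigidity_row_pair Finite_Cartesian_Product.vec_eq_iff field_simps)
      next
        case 3
        then show ?thesis using \<omega>[of b] ne c ab
          by (simp add: rigidity_row_pair Finite_Cartesian_Product.vec_eq_iff field_simps)
      next
        case 4
        then show ?thesis using \<omega>[of w] ne c ab
          by (simp add: rigidity_row_pair)
      qed
    qed
    finally show ?thesis .
  qed
  then have *: "\<forall>e\<in>insert {a, b} F0. \<omega>' e = 0" using sf unfolding stress_free_def by blast
  have "\<omega> {v, a} = 0" using * by (simp add: \<omega>'_def)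
  moreover have "\<omega> e = 0" if "e \<in> F0" for e
    using * that F0(2) by (auto simp: \<omega>'_def split: if_splits)
  ultimately show "\<forall>e\<in>?F. \<omega> e = 0" using c ab by auto
qed

text \<open>If no pair among the three neighbours can be inserted, each lies in a tight set of
  \<open>F0\<close>, and these merge into a tight \<open>T\<close> containing all three. Adding
  \<open>v\<close> brings three more edges but raises the sparsity bound only by 2.\<close>

lemma sparse_Henneberg_reduction:
  assumes F: "laman_sparse F" "finite F" "\<And>e. e \<in> F \<Longrightarrow> card e = 2"
    and N: "{e \<in> F. v \<in> e} = {{v, a}, {v, b}, {v, c}}"
    and ne: "a \<noteq> b" "a \<noteq> c" "b \<noteq> c" "v \<noteq> a" "v \<noteq> b" "v \<noteq> c"
    and F0: "F0 = {e \<in> F. v \<notin> e}"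
  shows "\<exists>x y. x \<noteq> y \<and> {x, y} \<subseteq> {a, b, c} \<and> {x, y} \<notin> F0 \<and> laman_sparse (insert {x, y} F0)"
proof (rule ccontr)
  assume neg: "\<not> ?thesis"
  have s0: "laman_sparse F0" "finite F0" "\<And>e. e \<in> F0 \<Longrightarrow> card e = 2"
    using sparse_mono[OF F(1)] F by (auto simp: F0)
  have block: "\<exists>T. tight F0 T \<and> {x, y} \<subseteq> T" if "x \<noteq> y" "{x, y} \<subseteq> {a, b, c}" for x y
  proof (rule not_sparse_insert[OF s0(1,2)])
    show "\<not> (laman_sparse (insert {x, y} F0) \<and> {x, y} \<notin> F0)" using neg that by metis
    show "card {x, y} = 2" using that(1) by simp
  qed
  obtain X where "tight F0 X" "{b, c} \<subseteq> X" using block[of b c] ne by auto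
  moreover obtain Y where "tight F0 Y" "{a, c} \<subseteq> Y" using block[of a c] ne by auto
  moreover obtain Z where "tight F0 Z" "{a, b} \<subseteq> Z" using block[of a b] ne by auto
  ultimately obtain T where T: "tight F0 T" "{a, b, c} \<subseteq> T"
    using tight_triangle[OF s0, of X Y Z a b c] ne by auto
  have "v \<notin> T" using tight_subset_Union[OF s0(1) T(1) s0(3)] by (auto simp: F0)
  have fT: "finite T" "2 \<le> card T" "card (F0 \<inter> Pow T) + 3 = 2 * card T"
    using T(1) by (auto simp: tight_def)
  have in_F: "{v, a} \<in> F" "{v, b} \<in> F" "{v, c} \<in> F" using N by blast+
  have "card ({{v, a}, {v, b}, {v, c}} \<union> F0 \<inter> Pow T) = 3 + card (F0 \<inter> Pow T)"
    using s0(2) ne \<open>v \<notin> T\<close> by (subst card_Un_disjoint) (auto simp: doubleton_eq_iff)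
  moreover have "card ({{v, a}, {v, b}, {v, c}} \<union> F0 \<inter> Pow T) \<le> card (F \<inter> Pow (insert v T))"
    using F(2) in_F T(2) by (intro card_mono) (auto simp: F0)
  moreover have "finite (insert v T)" "2 \<le> card (insert v T)" using fT \<open>v \<notin> T\<close> by simp_all
  then have "card (F \<inter> Pow (insert v T)) + 3 \<le> 2 * card (insert v T)"
    using F(1) unfolding laman_sparse_def by blast
  ultimately show False using fT \<open>v \<notin> T\<close> by simp
qed

text \<open>Laman's theorem, by induction along Henneberg moves.\<close>

theorem sparse_imp_stress_free:
  assumes p: "generic_framework G p" and fin: "finite (pverts G)"
    and F: "F \<subseteq> Pow (pverts G)" "\<And>e. e \<in> F \<Longrightarrow> card e = 2" "laman_sparse F"
  shows "stress_free F p"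
  using F
proof (induction "card F" arbitrary: F rule: less_induct)
  case less
  have finF: "finite F" using less(2) fin finite_subset by blast
  show ?case
  proof (cases "F = {}")
    case True
    then show ?thesis by (simp add: stress_free_def)
  next
    case False
    obtain v where v: "1 \<le> card {e \<in> F. v \<in> e}" "card {e \<in> F. v \<in> e} \<le> 3"
      using exists_low_degree[OF less(4) finF False less(3)] by blast
    define N where "N = {e \<in> F. v \<in> e}"
    define F0 where "F0 = {e \<in> F. v \<notin> e}"
    have nbr: "\<exists>a. e = {v, a} \<and> v \<noteq> a \<and> a \<in> pverts G \<and> v \<in> pverts G" if e: "e \<in> N" for e
    proof -
      have "card e = 2" "v \<in> e" "e \<subseteq> pverts G" using e less(2,3) by (auto simp: N_def)
      then show ?thesis by (auto simp: card_2_iff)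
    qed
    have split: "F = N \<union> F0" "N \<inter> F0 = {}" by (auto simp: N_def F0_def)
    have finN: "finite N" "finite F0" using finF by (auto simp: N_def F0_def)
    have cF: "card F = card N + card F0"
      using split finN card_Un_disjoint by metis
    have F0: "F0 \<subseteq> Pow (pverts G)" "\<And>e. e \<in> F0 \<Longrightarrow> card e = 2" "laman_sparse F0"
      using less(2-4) sparse_mono[OF less(4) _ finF] by (auto simp: F0_def)
    have sf0: "stress_free F0 p"
      using less(1)[OF _ F0] cF v(1) by (simp add: N_def)
    consider "card N = 1" | "card N = 2" | "card N = 3"
      using v by (fold N_def) linarith
    then show ?thesis
    proof cases
      case 1
      then obtain e where "N = {e}" by (auto simp: card_1_singleton_iff)
      then obtain a where N: "N = {{v, a}}" and va: "v \<noteq> a" "{v, a} \<subseteq> pverts G"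
        using nbr by auto
      have *: "{e. e \<in> F \<and> v \<in> e} = {{v, a}}" using N by (simp add: N_def)
      show ?thesis
      proof (rule stress_free_add_vertex[OF finF sf0[unfolded F0_def]])
        fix \<omega> assume "(\<Sum>e | e \<in> F \<and> v \<in> e. \<omega> e *\<^sub>R rigidity_row p e v) = 0"
        then have "\<omega> {v, a} = 0"
          unfolding * using va generic_inj[OF p va(2,1)] by (simp add: rigidity_row_pair)
        moreover have "e \<in> {{v, a}}" if "e \<in> F" "v \<in> e" for e
          using that by (simp flip: *)
        ultimately show "\<forall>e\<in>F. v \<in> e \<longrightarrow> \<omega> e = 0" by blast
      qed
    next
      case 2
      then obtain e f where "N = {e, f}" "e \<noteq> f" by (auto simp: card_2_iff)
      then obtain a b where N: "N = {{v, a}, {v, b}}" and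
        ab: "v \<noteq> a" "v \<noteq> b" "a \<noteq> b" "{v, a, b} \<subseteq> pverts G"
        using nbr[of e] nbr[of f] by auto
      have *: "{e. e \<in> F \<and> v \<in> e} = {{v, a}, {v, b}}" using N by (simp add: N_def)
      have nc: "cross (p a - p v) (p b - p v) \<noteq> 0"
        using generic_not_collinear[OF p, of v a b] ab by simp
      show ?thesis
      proof (rule stress_free_add_vertex[OF finF sf0[unfolded F0_def]])
        fix \<omega> assume "(\<Sum>e | e \<in> F \<and> v \<in> e. \<omega> e *\<^sub>R rigidity_row p e v) = 0"
        then have "\<omega> {v, a} *\<^sub>R (p v - p a) + \<omega> {v, b} *\<^sub>R (p v - p b) = 0"
          unfolding * using ab by (simp add: rigidity_row_pair doubleton_eq_iff)
        then have "(- \<omega> {v, a}) *\<^sub>R (p a - p v) + (- \<omega> {v, b}) *\<^sub>R (p b - p v) = 0"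
          by (simp add: algebra_simps)
        from cross_zero_combination[OF this nc] have "\<omega> {v, a} = 0" "\<omega> {v, b} = 0" by auto
        moreover have "e \<in> {{v, a}, {v, b}}" if "e \<in> F" "v \<in> e" for e
          using that by (simp flip: *)
        ultimately show "\<forall>e\<in>F. v \<in> e \<longrightarrow> \<omega> e = 0" by blast
      qed
    next
      case 3
      then obtain e f g where "N = {e, f, g}" "e \<noteq> f" "e \<noteq> g" "f \<noteq> g" by (auto simp: card_3_iff)
      then obtain a b c where N: "N = {{v, a}, {v, b}, {v, c}}" and
        abc: "a \<noteq> b" "a \<noteq> c" "b \<noteq> c" "v \<noteq> a" "v \<noteq> b" "v \<noteq> c" "{v, a, b, c} \<subseteq> pverts G"
        using nbr[of e] nbr[of f] nbr[of g] by auto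
      obtain x y where xy: "x \<noteq> y" "{x, y} \<subseteq> {a, b, c}" "{x, y} \<notin> F0" "laman_sparse (insert {x, y} F0)"
        using sparse_Henneberg_reduction[OF less(4) finF less(3) N[unfolded N_def] abc(1-6) F0_def]
        by blast
      have "\<exists>z. {a, b, c} = {x, y, z} \<and> z \<noteq> x \<and> z \<noteq> y" using xy(1,2) abc(1-3) by auto
      then obtain z where z: "{a, b, c} = {x, y, z}" "z \<noteq> x" "z \<noteq> y" by blast
      have xyz: "v \<noteq> x" "v \<noteq> y" "v \<noteq> z" "{x, y, z} \<subseteq> pverts G"
        using abc z(1) by blast+
      have "(\<lambda>w. {v, w}) ` {a, b, c} = (\<lambda>w. {v, w}) ` {x, y, z}" using z(1) by simp
      then have N': "N = {{v, x}, {v, y}, {v, z}}" using N by simp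
      have sf1: "stress_free (insert {x, y} F0) p"
      proof (rule less(1))
        show "card (insert {x, y} F0) < card F" using cF 3 xy(3) finN(2) by simp
        show "insert {x, y} F0 \<subseteq> Pow (pverts G)" using F0(1) xyz(4) by auto
        show "\<And>e. e \<in> insert {x, y} F0 \<Longrightarrow> card e = 2" using F0(2) xy(1) by auto
        show "laman_sparse (insert {x, y} F0)" by (rule xy(4))
      qed
      have "cross (p y - p x) (p z - p x) \<noteq> 0"
        using generic_not_collinear[OF p, of x y z] xyz(4) xy(1) z by simp
      \<comment> \<open>The placement with \<open>v\<close> at a midpoint is not generic; it only
        witnesses that the Gram determinant of \<open>F\<close> is a nonzero polynomial.\<close>
      then have "stress_free (insert {v, x} (insert {v, y} (insert {v, z} F0)))
          (p(v := (1/2) *\<^sub>R (p x + p y)))"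
        using xy(1,3) xyz z finN(2) sf1
        by (intro stress_free_split_edge) (auto simp: F0_def)
      moreover have "insert {v, x} (insert {v, y} (insert {v, z} F0)) = F"
        unfolding split(1) N' by auto
      ultimately show ?thesis using stress_free_generic[OF p fin less(2)] by metis
    qed
  qed
qed

section \<open>Rigidity\<close>

text \<open>Gaussian elimination: an equation with a nonzero coefficient at \<open>k\<close> is
  solved for the unknown \<open>k\<close>, and \<open>B\<close> is the system that remains for the
  other unknowns.\<close>

lemma underdetermined_system:
  fixes A :: "'i \<Rightarrow> 'j \<Rightarrow> real"
  assumes "finite I" "finite J" "card I < card J"
  shows "\<exists>x. (\<exists>j\<in>J. x j \<noteq> 0) \<and> (\<forall>i\<in>I. (\<Sum>j\<in>J. A i j * x j) = 0)"
  using assms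
proof (induction I arbitrary: J A rule: finite_induct)
  case empty
  then have "J \<noteq> {}" by auto
  then show ?case by (intro exI[of _ "\<lambda>_. 1"]) auto
next
  case (insert i I)
  show ?case
  proof (cases "\<forall>j\<in>J. A i j = 0")
    case True
    have "card I < card J" using insert by simp
    then obtain x where "\<exists>j\<in>J. x j \<noteq> 0" "\<forall>i\<in>I. (\<Sum>j\<in>J. A i j * x j) = 0"
      using insert.IH[OF insert.prems(1), of A] by blast
    then show ?thesis using True by (intro exI[of _ x]) auto
  next
    case False
    then obtain k where k: "k \<in> J" "A i k \<noteq> 0" by blast
    define B where "B i' j = A i' j - A i' k * A i j / A i k" for i' j
    have "card I < card (J - {k})" using insert k by simp
    then obtain x where x: "\<exists>j\<in>J - {k}. x j \<noteq> 0" "\<forall>i\<in>I. (\<Sum>j\<in>J - {k}. B i j * x j) = 0"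
      using insert.IH[OF finite_Diff[OF insert.prems(1)], of "{k}" B] by blast
    define s where "s = (\<Sum>j\<in>J - {k}. A i j * x j)"
    define y where "y j = (if j = k then - s / A i k else x j)" for j
    have y: "(\<Sum>j\<in>J. A i' j * y j) = (\<Sum>j\<in>J - {k}. A i' j * x j) - A i' k * s / A i k" for i'
    proof -
      have "(\<Sum>j\<in>J - {k}. A i' j * y j) = (\<Sum>j\<in>J - {k}. A i' j * x j)"
        by (intro sum.cong) (auto simp: y_def)
      then show ?thesis using sum.remove[OF insert.prems(1) k(1), of "\<lambda>j. A i' j * y j"]
        by (simp add: y_def)
    qed
    have "(\<Sum>j\<in>J. A i' j * y j) = 0" if "i' \<in> I" for i'
    proof -
      have "0 = (\<Sum>j\<in>J - {k}. B i' j * x j)" using x(2) that by simp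
      also have "\<dots> = (\<Sum>j\<in>J - {k}. A i' j * x j) - A i' k / A i k * s"
        unfolding s_def B_def sum_distrib_left
        by (simp add: sum_subtractf algebra_simps diff_divide_distrib)
      finally show ?thesis by (simp add: y)
    qed
    moreover have "(\<Sum>j\<in>J. A i j * y j) = 0" using k(2) by (simp add: y s_def)
    moreover have "\<exists>j\<in>J. y j \<noteq> 0" using x(1) by (auto simp: y_def)
    ultimately show ?thesis by auto
  qed
qed

text \<open>The pairing of a row with velocities \<open>u\<close> is half the rate of change of the
  squared length of the edge, so the infinitesimal motions are the velocities annihilated by all
  rows.\<close>

lemma sum_rigidity_row_inner:
  assumes "i \<noteq> j" "{i, j} \<subseteq> V" "finite V"
  shows "(\<Sum>v\<in>V. rigidity_row m {i, j} v \<bullet> u v) = (m i - m j) \<bullet> (u i - u j)"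
proof -
  have "(\<Sum>v\<in>V. rigidity_row m {i, j} v \<bullet> u v) = (\<Sum>v\<in>{i, j}. rigidity_row m {i, j} v \<bullet> u v)"
    using assms by (intro sum.mono_neutral_right) (auto simp: rigidity_row_def)
  then show ?thesis using assms(1) by (simp add: rigidity_row_pair inner_diff_left inner_diff_right)
qed

text \<open>An edge exerts opposite forces at its two ends, directed along the line through them, so
  it contributes neither a resultant force nor a resultant torque.\<close>

lemma sum_rigidity_row:
  assumes "card e = 2" "e \<subseteq> V" "finite V"
  shows "(\<Sum>v\<in>V. rigidity_row m e v) = 0" "(\<Sum>v\<in>V. cross (m v) (rigidity_row m e v)) = 0"
proof -
  obtain i j where e: "e = {i, j}" "i \<noteq> j" using assms(1) by (auto simp: card_2_iff)
  have "(\<Sum>v\<in>V. rigidity_row m e v) = (\<Sum>v\<in>e. rigidity_row m e v)"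
    using assms by (intro sum.mono_neutral_right) (auto simp: rigidity_row_def)
  moreover have "(\<Sum>v\<in>V. cross (m v) (rigidity_row m e v)) =
      (\<Sum>v\<in>e. cross (m v) (rigidity_row m e v))"
    using assms by (intro sum.mono_neutral_right) (auto simp: rigidity_row_def cross_def)
  ultimately show "(\<Sum>v\<in>V. rigidity_row m e v) = 0" "(\<Sum>v\<in>V. cross (m v) (rigidity_row m e v)) = 0"
    using e(2) unfolding e(1) by (auto simp: rigidity_row_pair cross_def algebra_simps)
qed

text \<open>Equilibrium of forces and torques makes three of the \<open>2 * card V\<close> equations for a stress
  redundant: both at \<open>a\<close> and one at \<open>b\<close>.\<close>

lemma not_stress_free:
  assumes V: "finite V" "{a, b} \<subseteq> V" "m a \<noteq> m b"
    and F: "F \<subseteq> Pow V" "\<And>e. e \<in> F \<Longrightarrow> card e = 2" "2 * card V < card F + 3"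
  shows "\<not> stress_free F m"
proof -
  have fF: "finite F" using V(1) F(1) finite_subset by blast
  have ab: "a \<noteq> b" using V(3) by auto
  have "m b - m a \<noteq> 0" using V(3) by simp
  then have "\<exists>c. vec_nth (m b - m a) c \<noteq> 0"
    unfolding Finite_Cartesian_Product.vec_eq_iff by simp
  then obtain c :: 2 where c: "vec_nth (m b - m a) c \<noteq> 0" by blast
  \<comment> \<open>The equations that are kept: both coordinates off \<open>a\<close> and
    \<open>b\<close>, and coordinate \<open>c\<close> at \<open>b\<close>. Their number is 2 * card
    V - 3, which is less than the number of edges.\<close>
  define I where "I = insert (b, c) ((V - {a, b}) \<times> UNIV)"
  have fI: "finite I" using V(1) by (simp add: I_def)
  have "card V = card (V - {a, b}) + 2"
    using V(1,2) ab card_Diff_subset[of "{a, b}" V] card_mono[OF V(1,2)] by simp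
  then have "card I < card F"
    using F(3) V(1) by (simp add: I_def card_cartesian_product)
  then obtain \<omega> where nz: "\<exists>e\<in>F. \<omega> e \<noteq> 0" and
    eq: "\<forall>i\<in>I. (\<Sum>e\<in>F. vec_nth (rigidity_row m e (fst i)) (snd i) * \<omega> e) = 0"
    using underdetermined_system[OF fI fF, of "\<lambda>i e. vec_nth (rigidity_row m e (fst i)) (snd i)"]
    by auto
  define S where "S v = (\<Sum>e\<in>F. \<omega> e *\<^sub>R rigidity_row m e v)" for v
  have S0: "vec_nth (S v) d = 0" if "(v, d) \<in> I" for v d
    using eq[rule_format, OF that] by (simp add: S_def mult.commute)
  have Sv: "S v = 0" if "v \<noteq> a" "v \<noteq> b" for v
  proof (cases "v \<in> V")
    case True
    then show ?thesis using that S0 by (auto simp: Finite_Cartesian_Product.vec_eq_iff I_def)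
  next
    case False
    then show ?thesis using F(1) unfolding S_def
      by (intro sum.neutral) (auto simp: rigidity_row_def)
  qed
  have "(\<Sum>v\<in>V. S v) = (\<Sum>e\<in>F. \<omega> e *\<^sub>R (\<Sum>v\<in>V. rigidity_row m e v))"
    unfolding S_def by (subst sum.swap) (simp add: scaleR_sum_right)
  also have "\<dots> = 0" using F sum_rigidity_row(1)[OF _ _ V(1)] by (intro sum.neutral) auto
  also have "(\<Sum>v\<in>V. S v) = (\<Sum>v\<in>{a, b}. S v)"
    using V Sv by (intro sum.mono_neutral_right) auto
  finally have Sa: "S a = - S b" using ab by (simp add: add_eq_0_iff)
  have cross_sum: "cross x (\<Sum>e\<in>F. \<omega> e *\<^sub>R g e) = (\<Sum>e\<in>F. \<omega> e * cross x (g e))" for x g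
    by (simp add: cross_def sum_distrib_left sum_subtractf algebra_simps)
  have "(\<Sum>v\<in>V. cross (m v) (S v)) = (\<Sum>e\<in>F. \<omega> e * (\<Sum>v\<in>V. cross (m v) (rigidity_row m e v)))"
    unfolding S_def cross_sum by (subst sum.swap) (simp add: sum_distrib_left)
  also have "\<dots> = 0" using F sum_rigidity_row(2)[OF _ _ V(1)] by (intro sum.neutral) auto
  also have "(\<Sum>v\<in>V. cross (m v) (S v)) = (\<Sum>v\<in>{a, b}. cross (m v) (S v))"
    using V Sv by (intro sum.mono_neutral_right) (auto simp: cross_def)
  \<comment> \<open>The torque balance makes \<open>S b\<close> parallel to
    \<open>m b - m a\<close>. As \<open>S b\<close> has coordinate \<open>c\<close> equal to 0 and
    \<open>m b - m a\<close> has not, \<open>S b\<close> vanishes.\<close>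
  finally have "cross (m b - m a) (S b) = 0"
    using ab Sa by (simp add: cross_def algebra_simps)
  moreover have "vec_nth (S b) c = 0" using S0 by (simp add: I_def)
  ultimately have Sb: "S b = 0"
    using c exhaust_2[of c] by (auto simp: cross_def Finite_Cartesian_Product.vec_eq_iff forall_2)
  then have "S a = 0" using Sa by simp
  then have "S v = 0" for v using Sb Sv[of v] by (cases "v = a \<or> v = b") auto
  then have 0: "\<forall>v. (\<Sum>e\<in>F. \<omega> e *\<^sub>R rigidity_row m e v) = 0" by (simp add: S_def)
  show ?thesis
  proof
    assume "stress_free F m"
    then have "\<forall>e\<in>F. \<omega> e = 0" using 0 unfolding stress_free_def by simp
    then show False using nz by blast
  qed
qed

text \<open>With \<open>{i, j}\<close> added there are 2 * card V - 2 rows, which are dependent.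
  Hence the row of \<open>{i, j}\<close> is a combination of rows of \<open>F\<close> and
  annihilates every motion that these annihilate.\<close>

lemma infinitesimal_motion_trivial:
  assumes V: "finite V" "{i, j} \<subseteq> V" "i \<noteq> j"
    and F: "F \<subseteq> Pow V" "\<And>e. e \<in> F \<Longrightarrow> card e = 2" "card F + 3 = 2 * card V" "stress_free F m"
    and u: "\<And>e. e \<in> F \<Longrightarrow> (\<Sum>v\<in>V. rigidity_row m e v \<bullet> u v) = 0"
  shows "(m i - m j) \<bullet> (u i - u j) = 0"
proof (cases "m i = m j \<or> {i, j} \<in> F")
  case True
  then show ?thesis using u[of "{i, j}"] sum_rigidity_row_inner[OF V(3,2,1)] by auto
next
  case False
  have fF: "finite F" using V(1) F(1) finite_subset by blast
  have "\<not> stress_free (insert {i, j} F) m"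
    using F V False fF by (intro not_stress_free[of V i j]) auto
  then obtain \<omega> where \<omega>: "\<forall>v. (\<Sum>e\<in>insert {i, j} F. \<omega> e *\<^sub>R rigidity_row m e v) = 0"
    and nz: "\<exists>e\<in>insert {i, j} F. \<omega> e \<noteq> 0"
    unfolding stress_free_def by blast
  have "\<omega> {i, j} \<noteq> 0"
  proof
    assume 0: "\<omega> {i, j} = 0"
    then have "\<forall>v. (\<Sum>e\<in>F. \<omega> e *\<^sub>R rigidity_row m e v) = 0" using \<omega> False fF by simp
    then have "\<forall>e\<in>F. \<omega> e = 0" using F(4) unfolding stress_free_def by blast
    then show False using 0 nz by blast
  qed
  have "0 = (\<Sum>v\<in>V. (\<Sum>e\<in>insert {i, j} F. \<omega> e *\<^sub>R rigidity_row m e v) \<bullet> u v)"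
    using \<omega> by simp
  also have "\<dots> = (\<Sum>e\<in>insert {i, j} F. \<omega> e * (\<Sum>v\<in>V. rigidity_row m e v \<bullet> u v))"
    unfolding inner_sum_left by (subst sum.swap) (simp add: sum_distrib_left)
  also have "\<dots> = \<omega> {i, j} * ((m i - m j) \<bullet> (u i - u j))"
    using fF False u sum_rigidity_row_inner[OF V(3,2,1)] by simp
  finally show ?thesis using \<open>\<omega> {i, j} \<noteq> 0\<close> by simp
qed

lemma gram_det_tendsto:
  assumes "\<And>v. v \<in> V \<Longrightarrow> ((\<lambda>k. q k v) \<longlongrightarrow> p v) L" "\<Union> (set es) \<subseteq> V"
  shows "((\<lambda>k. gram_det V es (q k)) \<longlongrightarrow> gram_det V es p) L"
proof -
  have row: "((\<lambda>k. rigidity_row (q k) e v) \<longlongrightarrow> rigidity_row p e v) L" if "e \<in> set es" for e v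
    using that assms unfolding rigidity_row_def
    by (auto intro!: tendsto_diff tendsto_scaleR tendsto_const tendsto_sum)
  have entry: "((\<lambda>k. gram V (q k) e f) \<longlongrightarrow> gram V p e f) L" if "e \<in> set es" "f \<in> set es" for e f
    using that row unfolding gram_def by (auto intro!: tendsto_sum tendsto_inner)
  have det: "gram_det V es r = (\<Sum>\<pi>\<in>{\<pi>. \<pi> permutes {0..<length es}}. of_int (sign \<pi>) *
      (\<Prod>i=0..<length es. gram V r (es ! i) (es ! \<pi> i)))" for r
    unfolding gram_det_def
    by (subst det_def'[of _ "length es"])
      (auto intro!: sum.cong prod.cong dest: permutes_in_image[where x = "_ :: nat"])
  show ?thesis
    unfolding det using entry
    by (auto intro!: tendsto_sum tendsto_mult tendsto_prod tendsto_const dest: permutes_in_image)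
qed

text \<open>Independence means that the Gram determinant is nonzero, an open condition since the
  determinant is continuous in the positions.\<close>

lemma stress_free_open:
  assumes "finite V" "F \<subseteq> Pow V" "stress_free F p"
  shows "\<exists>\<epsilon>>0. \<forall>m. (\<forall>v\<in>V. norm (p v - m v) < \<epsilon>) \<longrightarrow> stress_free F m"
proof (rule ccontr)
  assume neg: "\<not> ?thesis"
  have "finite F" using assms finite_subset by blast
  then obtain es where es: "distinct es" "set es = F" using finite_distinct_list by metis
  note iff = stress_free_iff_gram_det[OF assms(1,2) es]
  have "\<exists>m. (\<forall>v\<in>V. norm (p v - m v) < inverse (real (Suc k))) \<and> \<not> stress_free F m" for k
    using neg by (metis inverse_positive_iff_positive of_nat_0_less_iff zero_less_Suc)
  then obtain m where m: "\<And>k v. v \<in> V \<Longrightarrow> norm (p v - m k v) < inverse (real (Suc k))"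
    "\<And>k. \<not> stress_free F (m k)" by metis
  have "(\<lambda>k. m k v) \<longlonglongrightarrow> p v" if "v \<in> V" for v
    by (rule metric_tendsto_imp_tendsto[OF LIMSEQ_inverse_real_of_nat])
      (use m(1)[OF that] in \<open>auto simp: dist_norm norm_minus_commute intro!: always_eventually less_imp_le\<close>)
  then have "(\<lambda>k. gram_det V es (m k)) \<longlonglongrightarrow> gram_det V es p"
    using assms(2) es by (intro gram_det_tendsto) auto
  then have "gram_det V es p = 0" using m(2) by (simp add: iff LIMSEQ_const_iff)
  then show False using assms(3) by (simp add: iff)
qed

text \<open>If \<open>q\<close> is equivalent to \<open>p\<close>, then \<open>q - p\<close> is an infinitesimal motion of the midpoint
  framework \<open>(p + q) / 2\<close>, because \<open>|q u - q v|\<^sup>2 - |p u - p v|\<^sup>2\<close> is the inner product of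
  the sum and the difference.\<close>

theorem rigid_if_spanning_sparse:
  assumes fin: "finite (pverts G)" and F: "\<And>e. e \<in> F \<Longrightarrow> \<exists>(u, v) \<in> parcs G. e = {u, v}"
    "F \<subseteq> Pow (pverts G)" "\<And>e. e \<in> F \<Longrightarrow> card e = 2" "laman_sparse F"
    "card F + 3 = 2 * card (pverts G)"
  shows "rigid_in_plane G"
  unfolding rigid_in_plane_def
proof (intro allI impI)
  fix p assume p: "generic_framework G p"
  \<comment> \<open>The midpoint framework need not be generic, so independence at it must come from
    nearness to \<open>p\<close>.\<close>
  obtain \<epsilon> where \<epsilon>: "\<epsilon> > 0"
    "\<And>m. (\<forall>v\<in>pverts G. norm (p v - m v) < \<epsilon>) \<Longrightarrow> stress_free F m"
    using stress_free_open[OF fin F(2) sparse_imp_stress_free[OF p fin F(2-4)]] by blast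
  have "congruent_frameworks G p q"
    if eqv: "equivalent_frameworks G p q" and close: "\<forall>u\<in>pverts G. norm (p u - q u) < \<epsilon>" for q
  proof -
    define m where "m v = (1/2) *\<^sub>R (p v + q v)" for v
    define d where "d v = q v - p v" for v
    have md: "(m u - m v) \<bullet> (d u - d v) = ((norm (q u - q v))\<^sup>2 - (norm (p u - p v))\<^sup>2) / 2" for u v
      unfolding m_def d_def power2_norm_eq_inner
      by (simp add: inner_diff_left inner_diff_right inner_add_left inner_add_right
          inner_commute field_simps)
    have "norm (p v - m v) < \<epsilon>" if "v \<in> pverts G" for v
    proof -
      have "p v - m v = (1/2) *\<^sub>R (p v - q v)"
        by (simp add: m_def Finite_Cartesian_Product.vec_eq_iff field_simps)
      then have "norm (p v - m v) = norm (p v - q v) / 2" by simp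
      moreover have "norm (p v - q v) < \<epsilon>" using close that by blast
      ultimately show ?thesis using norm_ge_zero[of "p v - q v"] by linarith
    qed
    then have sf: "stress_free F m" using \<epsilon>(2) by blast
    have mot: "(\<Sum>v\<in>pverts G. rigidity_row m e v \<bullet> d v) = 0" if e: "e \<in> F" for e
    proof -
      obtain u v where uv: "(u, v) \<in> parcs G" "e = {u, v}" using F(1)[OF e] by auto
      have "u \<noteq> v" using F(3)[OF e] uv(2) by auto
      moreover have "norm (p u - p v) = norm (q u - q v)"
        using eqv uv(1) by (auto simp: equivalent_frameworks_def)
      ultimately show ?thesis
        using sum_rigidity_row_inner[of u v "pverts G" m d] F(2) e fin uv(2) md by auto
    qed
    show ?thesis unfolding congruent_frameworks_def
    proof (intro ballI)
      fix u v assume uv: "u \<in> pverts G" "v \<in> pverts G"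
      show "norm (p u - p v) = norm (q u - q v)"
      proof (cases "u = v")
        case False
        have "(m u - m v) \<bullet> (d u - d v) = 0"
          by (rule infinitesimal_motion_trivial[OF fin _ False F(2,3,5) sf mot]) (use uv in auto)
        then have "(norm (p u - p v))\<^sup>2 = (norm (q u - q v))\<^sup>2" using md by simp
        then show ?thesis by simp
      qed simp
    qed
  qed
  then show "\<exists>\<epsilon>>0. \<forall>q. equivalent_frameworks G p q \<and> (\<forall>u\<in>pverts G. norm (p u - q u) < \<epsilon>) \<longrightarrow>
      congruent_frameworks G p q" using \<epsilon>(1) by blast
qed

section \<open>Edge sets and the cover by rigid components\<close>

definition edge_set :: "'a pair_pre_digraph \<Rightarrow> 'a set set" where
  "edge_set G = (\<lambda>(u, v). {u, v}) ` parcs G"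

lemma pair_graph_facts:
  assumes "pair_graph G"
  shows "finite (pverts G)" "finite (parcs G)" "(u, v) \<in> parcs G \<Longrightarrow> u \<in> pverts G"
    "(u, v) \<in> parcs G \<Longrightarrow> v \<in> pverts G" "(u, v) \<in> parcs G \<Longrightarrow> (v, u) \<in> parcs G"
    "(u, u) \<notin> parcs G"
proof -
  interpret pair_graph G by fact
  show "finite (pverts G)" "finite (parcs G)" by (rule pair_finite_verts pair_finite_arcs)+
  show "(u, v) \<in> parcs G \<Longrightarrow> u \<in> pverts G" "(u, v) \<in> parcs G \<Longrightarrow> v \<in> pverts G"
    by (auto dest: wellformed')
  show "(u, v) \<in> parcs G \<Longrightarrow> (v, u) \<in> parcs G"
    using pair_sym_arcs by (auto simp: symmetric_def dest: symD)
  show "(u, u) \<notin> parcs G" using pair_no_loops by fastforce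
qed

lemma edge_set_facts:
  assumes "pair_graph G"
  shows "finite (edge_set G)" "edge_set G \<subseteq> Pow (pverts G)" "e \<in> edge_set G \<Longrightarrow> card e = 2"
    "{u, v} \<in> edge_set G \<longleftrightarrow> (u, v) \<in> parcs G"
proof -
  note facts = pair_graph_facts[OF assms]
  show "finite (edge_set G)" using facts(2) by (simp add: edge_set_def)
  show "edge_set G \<subseteq> Pow (pverts G)" using facts(3,4) by (auto simp: edge_set_def)
  show "card e = 2" if e: "e \<in> edge_set G"
  proof -
    obtain u v where uv: "(u, v) \<in> parcs G" "e = {u, v}" using e by (auto simp: edge_set_def)
    then have "u \<noteq> v" using facts(6) by auto
    then show ?thesis using uv(2) by simp
  qed
  show "{u, v} \<in> edge_set G \<longleftrightarrow> (u, v) \<in> parcs G"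
    using facts(5) by (force simp: edge_set_def doubleton_eq_iff)
qed

text \<open>The maximal tight sets of a maximal independent edge set are the rigid components.\<close>

theorem not_rigid_imp_cover:
  assumes G: "pair_graph G" and nr: "\<not> rigid_in_plane G" and two: "2 \<le> card (pverts G)"
  obtains \<X> where "finite \<X>" "\<And>X. X \<in> \<X> \<Longrightarrow> X \<subseteq> pverts G" "\<And>X. X \<in> \<X> \<Longrightarrow> 2 \<le> card X"
    "\<And>X Y. X \<in> \<X> \<Longrightarrow> Y \<in> \<X> \<Longrightarrow> X \<noteq> Y \<Longrightarrow> card (X \<inter> Y) \<le> 1"
    "\<And>e. e \<in> edge_set G \<Longrightarrow> \<exists>X\<in>\<X>. e \<subseteq> X"
    "(\<Sum>X\<in>\<X>. 2 * card X - 3) + 4 \<le> 2 * card (pverts G)"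
proof -
  note V = pair_graph_facts(1)[OF G] and E = edge_set_facts[OF G]
  let ?S = "{F. F \<subseteq> edge_set G \<and> laman_sparse F}"
  have "finite ?S"
    by (rule rev_finite_subset[of "Pow (edge_set G)"]) (use E(1) in auto)
  moreover have "{} \<in> ?S" by (simp add: laman_sparse_def)
  ultimately obtain F where "F \<in> ?S" and max': "\<forall>F'\<in>?S. F \<subseteq> F' \<longrightarrow> F = F'"
    using finite_has_maximal2[of ?S "{}"] by meson
  then have F: "F \<subseteq> edge_set G" "laman_sparse F" by simp_all
  have max: "F = F'" if "F' \<subseteq> edge_set G" "laman_sparse F'" "F \<subseteq> F'" for F'
    using max' that by simp
  have finF: "finite F" using F(1) E(1) finite_subset by blast
  have c2: "card e = 2" if "e \<in> F" for e using that F(1) E(3) by blast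
  have FV: "F \<subseteq> Pow (pverts G)" using F(1) E(2) by blast
  define \<T> where "\<T> = {X. tight F X}"
  have \<T>V: "X \<subseteq> pverts G" if "X \<in> \<T>" for X
    using tight_subset_Union[OF F(2) _ c2, of X] that FV by (auto simp: \<T>_def)
  have fin\<T>: "finite \<T>"
    by (rule finite_subset[of _ "Pow (pverts G)"]) (use \<T>V V in auto)
  define \<X> where "\<X> = {X \<in> \<T>. \<forall>Y\<in>\<T>. X \<subseteq> Y \<longrightarrow> X = Y}"
  have above: "\<exists>X\<in>\<X>. T \<subseteq> X" if T: "T \<in> \<T>" for T
  proof -
    obtain m where "m \<in> \<T>" "T \<subseteq> m" "\<forall>Y\<in>\<T>. m \<subseteq> Y \<longrightarrow> m = Y"
      using finite_has_maximal2[OF fin\<T> T] by meson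
    then show ?thesis by (intro bexI[of _ m]) (simp_all add: \<X>_def)
  qed
  have inter: "card (X \<inter> Y) \<le> 1" if XY: "X \<in> \<X>" "Y \<in> \<X>" "X \<noteq> Y" for X Y
  proof (rule ccontr)
    assume "\<not> card (X \<inter> Y) \<le> 1"
    then have "X \<union> Y \<in> \<T>"
      using XY tight_Un[OF F(2) finF, of X Y] by (simp add: \<X>_def \<T>_def)
    then have "X = X \<union> Y" "Y = X \<union> Y" using XY(1,2) unfolding \<X>_def by blast+
    then show False using XY(3) by blast
  qed
  \<comment> \<open>By maximality of \<open>F\<close>, every edge either belongs to \<open>F\<close>
    or cannot be inserted; in both cases it lies in a tight set.\<close>
  have cover: "\<exists>X\<in>\<X>. e \<subseteq> X" if e: "e \<in> edge_set G" for e
  proof -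
    have "\<not> (laman_sparse (insert e F) \<and> e \<notin> F)"
      using max[of "insert e F"] e F(1) by auto
    then obtain T where "tight F T" "e \<subseteq> T"
      using not_sparse_insert[OF F(2) finF _ E(3)[OF e]] by blast
    then show ?thesis using above[of T] by (auto simp: \<T>_def)
  qed
  have two_le: "2 \<le> card X" and count: "card (F \<inter> Pow X) = 2 * card X - 3" if "X \<in> \<X>" for X
    using that by (auto simp: \<X>_def \<T>_def tight_def)
  have disj: "F \<inter> Pow X \<inter> (F \<inter> Pow Y) = {}" if XY: "X \<in> \<X>" "Y \<in> \<X>" "X \<noteq> Y" for X Y
  proof (rule ccontr)
    assume "F \<inter> Pow X \<inter> (F \<inter> Pow Y) \<noteq> {}"
    then obtain e where e: "e \<in> F" "e \<subseteq> X \<inter> Y" by auto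
    have "finite (X \<inter> Y)" using XY(1) \<T>V V finite_subset by (fastforce simp: \<X>_def)
    then have "card e \<le> card (X \<inter> Y)" using e(2) by (rule card_mono)
    then show False using inter[OF XY] c2[OF e(1)] by simp
  qed
  \<comment> \<open>Each edge of \<open>F\<close> lies in exactly one maximal tight set, so the
    weights add up to \<open>card F\<close>.\<close>
  have "(\<Sum>X\<in>\<X>. 2 * card X - 3) = (\<Sum>X\<in>\<X>. card (F \<inter> Pow X))" using count by simp
  also have "\<dots> = card (\<Union>X\<in>\<X>. F \<inter> Pow X)"
    using fin\<T> finF disj by (intro card_UN_disjoint[symmetric]) (auto simp: \<X>_def)
  also have "(\<Union>X\<in>\<X>. F \<inter> Pow X) = F" using cover F(1) by blast
  finally have sum: "(\<Sum>X\<in>\<X>. 2 * card X - 3) = card F" .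
  have "F \<inter> Pow (pverts G) = F" using FV by blast
  then have le: "card F + 3 \<le> 2 * card (pverts G)"
    using F(2) V two unfolding laman_sparse_def by metis
  \<comment> \<open>Equality would make \<open>G\<close> rigid. This improves the sparsity bound by
    one, from 2 n - 3 to 2 n - 4.\<close>
  have "card F + 3 \<noteq> 2 * card (pverts G)"
  proof
    assume "card F + 3 = 2 * card (pverts G)"
    moreover have "\<exists>(u, v)\<in>parcs G. e = {u, v}" if "e \<in> F" for e
      using that F(1) unfolding edge_set_def by fast
    ultimately have "rigid_in_plane G"
      using rigid_if_spanning_sparse[OF V _ FV c2 F(2)] by blast
    then show False using nr by blast
  qed
  then have "(\<Sum>X\<in>\<X>. 2 * card X - 3) + 4 \<le> 2 * card (pverts G)" using le sum by simp
  moreover have "finite \<X>" using fin\<T> by (simp add: \<X>_def)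
  moreover have "X \<subseteq> pverts G" if "X \<in> \<X>" for X using that \<T>V by (simp add: \<X>_def)
  ultimately show thesis using that two_le inter cover by blast
qed

section \<open>The spectral radius\<close>

definition nbrs :: "'a pair_pre_digraph \<Rightarrow> 'a \<Rightarrow> 'a set" where
  "nbrs G u = {v \<in> pverts G. (u, v) \<in> parcs G}"

definition quad_form :: "'a pair_pre_digraph \<Rightarrow> ('a \<Rightarrow> real) \<Rightarrow> real" where
  "quad_form G x = (\<Sum>u\<in>pverts G. x u * (\<Sum>v\<in>nbrs G u. x v))"

text \<open>The first-order condition at a maximum, obtained without derivatives by testing t = c /
  s with s larger than the absolute value of \<open>d\<close>.\<close>

lemma linear_dominated_by_square:
  fixes c d :: real
  assumes "\<And>t. 2 * t * c + t\<^sup>2 * d \<le> 0"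
  shows "c = 0"
proof (rule ccontr)
  assume "c \<noteq> 0"
  define s where "s = \<bar>d\<bar> + 1"
  have s: "s > 0" "d \<ge> - s" by (auto simp: s_def)
  have "2 * (c / s) * c + (c / s)\<^sup>2 * d = (c / s)\<^sup>2 * (2 * s + d)"
    using s by (simp add: field_simps power2_eq_square)
  moreover have "(c / s)\<^sup>2 * (2 * s + d) > 0"
    using s \<open>c \<noteq> 0\<close> by (intro mult_pos_pos) auto
  ultimately show False using assms[of "c / s"] by linarith
qed

lemma sum_squares_pos:
  fixes y :: "'a \<Rightarrow> real"
  assumes "finite V" "\<exists>u\<in>V. y u \<noteq> 0"
  shows "0 < (\<Sum>u\<in>V. (y u)\<^sup>2)"
proof -
  obtain u where "u \<in> V" "y u \<noteq> 0" using assms(2) by blast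
  then show ?thesis by (intro sum_pos2[OF assms(1)]) auto
qed

text \<open>The functions live on the whole type. Being 0 outside \<open>V\<close> puts them into a
  product of compact intervals, in which the norm condition is closed.\<close>

lemma compact_unit_sphere:
  assumes "finite V"
  shows "compact {x :: 'a \<Rightarrow> real. (\<forall>u. u \<notin> V \<longrightarrow> x u = 0) \<and> (\<Sum>u\<in>V. (x u)\<^sup>2) = 1}"
proof -
  let ?B = "\<lambda>u. if u \<in> V then {-1..1 :: real} else {0}"
  have "compactin (product_topology (\<lambda>_. euclidean) UNIV) (PiE UNIV ?B)"
    by (subst compactin_PiE) auto
  then have "compact (PiE UNIV ?B)" by (simp add: euclidean_product_topology)
  moreover have "closed {x :: 'a \<Rightarrow> real. (\<Sum>u\<in>V. (x u)\<^sup>2) = 1}"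
    by (intro closed_Collect_eq continuous_intros continuous_on_product_coordinates)
  ultimately have "compact (PiE UNIV ?B \<inter> {x. (\<Sum>u\<in>V. (x u)\<^sup>2) = 1})"
    by (rule compact_Int_closed)
  moreover have "PiE UNIV ?B \<inter> {x. (\<Sum>u\<in>V. (x u)\<^sup>2) = 1} =
      {x. (\<forall>u. u \<notin> V \<longrightarrow> x u = 0) \<and> (\<Sum>u\<in>V. (x u)\<^sup>2) = 1}"
  proof -
    have "-1 \<le> x u \<and> x u \<le> 1" if x: "(\<Sum>u\<in>V. (x u)\<^sup>2) = 1" and u: "u \<in> V" for x :: "'a \<Rightarrow> real" and u
    proof -
      have "(x u)\<^sup>2 \<le> (\<Sum>u\<in>V. (x u)\<^sup>2)" using u assms by (intro member_le_sum) auto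
      then have "\<bar>x u\<bar> \<le> 1" using x by (simp add: abs_square_le_1)
      then show ?thesis by linarith
    qed
    then show ?thesis by (auto simp: PiE_UNIV_domain Pi_def split: if_splits)
  qed
  ultimately show ?thesis by simp
qed

lemma quad_form_cong:
  "(\<And>u. u \<in> pverts G \<Longrightarrow> x u = y u) \<Longrightarrow> quad_form G x = quad_form G y"
  unfolding quad_form_def nbrs_def by (auto intro!: sum.cong arg_cong2[where f = "(*)"])

lemma quad_form_scale: "quad_form G (\<lambda>u. c * x u) = c\<^sup>2 * quad_form G x"
  by (simp add: quad_form_def sum_distrib_left power2_eq_square mult_ac)

lemma sum_nbrs_swap:
  fixes f g :: "'a \<Rightarrow> real"
  assumes "pair_graph G"
  shows "(\<Sum>u\<in>pverts G. f u * (\<Sum>v\<in>nbrs G u. g v)) = (\<Sum>v\<in>pverts G. g v * (\<Sum>u\<in>nbrs G v. f u))"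
proof -
  note facts = pair_graph_facts[OF assms]
  have "(\<Sum>u\<in>pverts G. f u * (\<Sum>v\<in>nbrs G u. g v)) =
      (\<Sum>u\<in>pverts G. \<Sum>v | v \<in> pverts G \<and> (u, v) \<in> parcs G. f u * g v)"
    by (simp add: nbrs_def sum_distrib_left)
  also have "\<dots> = (\<Sum>v\<in>pverts G. \<Sum>u | u \<in> pverts G \<and> (u, v) \<in> parcs G. f u * g v)"
    by (rule sum.swap_restrict[OF facts(1,1)])
  also have "\<dots> = (\<Sum>v\<in>pverts G. g v * (\<Sum>u\<in>nbrs G v. f u))"
    using facts(5) unfolding nbrs_def sum_distrib_left by (intro sum.cong) (auto simp: mult.commute)
  finally show ?thesis .
qed

lemma quad_form_add_scaled:
  assumes "pair_graph G"
  shows "quad_form G (\<lambda>u. x u + t * z u) =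
    quad_form G x + 2 * t * (\<Sum>u\<in>pverts G. z u * (\<Sum>v\<in>nbrs G u. x v)) + t\<^sup>2 * quad_form G z"
proof -
  have "quad_form G (\<lambda>u. x u + t * z u) =
    quad_form G x + t * (\<Sum>u\<in>pverts G. z u * (\<Sum>v\<in>nbrs G u. x v)) +
      t * (\<Sum>u\<in>pverts G. x u * (\<Sum>v\<in>nbrs G u. z v)) + t\<^sup>2 * quad_form G z"
    unfolding quad_form_def
    by (simp add: sum.distrib sum_distrib_left algebra_simps power2_eq_square)
  then show ?thesis unfolding sum_nbrs_swap[OF assms, of x z] by simp
qed

text \<open>The maximum of the quadratic form on the unit sphere is attained, and taking absolute
  values of a maximizer does not decrease the form. Stationarity makes the result an eigenvector,
  and every eigenvalue is a value of the Rayleigh quotient, hence at most this maximum.\<close>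

lemma perron_vector:
  assumes G: "pair_graph G" and ne: "pverts G \<noteq> {}"
  obtains x where "\<And>u. u \<in> pverts G \<Longrightarrow> 0 \<le> x u" "\<exists>u\<in>pverts G. x u \<noteq> 0"
    "\<And>u. u \<in> pverts G \<Longrightarrow> (\<Sum>v\<in>nbrs G u. x v) = graph_spectral_radius G * x u"
    "\<And>y. quad_form G y \<le> graph_spectral_radius G * (\<Sum>u\<in>pverts G. (y u)\<^sup>2)"
proof -
  let ?V = "pverts G"
  note facts = pair_graph_facts[OF G]
  define S where "S = {x :: 'a \<Rightarrow> real. (\<forall>u. u \<notin> ?V \<longrightarrow> x u = 0) \<and> (\<Sum>u\<in>?V. (x u)\<^sup>2) = 1}"
  obtain w where w: "w \<in> ?V" using ne by blast
  have "(\<lambda>u. if u = w then 1 else 0) \<in> S"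
    using w facts(1) by (auto simp: S_def if_distrib[of "\<lambda>t. t\<^sup>2"] sum.delta cong: if_cong)
  then have "S \<noteq> {}" by blast
  moreover have "continuous_on S (quad_form G)"
    unfolding quad_form_def
    by (intro continuous_intros continuous_on_subset[OF continuous_on_product_coordinates]) auto
  moreover have "compact S" unfolding S_def by (rule compact_unit_sphere[OF facts(1)])
  ultimately obtain x0 where x0: "x0 \<in> S" "\<And>y. y \<in> S \<Longrightarrow> quad_form G y \<le> quad_form G x0"
    using continuous_attains_sup[of S "quad_form G"] by auto
  define r where "r = quad_form G x0"
  have ray: "quad_form G y \<le> r * (\<Sum>u\<in>?V. (y u)\<^sup>2)" for y
  proof (cases "\<forall>u\<in>?V. y u = 0")
    case True
    then have "quad_form G y = quad_form G (\<lambda>_. 0)" by (intro quad_form_cong) auto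
    then show ?thesis using True by (simp add: quad_form_def)
  next
    case False
    define s where "s = (\<Sum>u\<in>?V. (y u)\<^sup>2)"
    have "s > 0" using False facts(1) unfolding s_def by (intro sum_squares_pos) auto
    define y' where "y' u = (if u \<in> ?V then y u / sqrt s else 0)" for u
    have "(\<Sum>u\<in>?V. (y' u)\<^sup>2) = (\<Sum>u\<in>?V. (y u)\<^sup>2 / s)"
      using \<open>s > 0\<close> by (intro sum.cong) (auto simp: y'_def power_divide)
    also have "\<dots> = 1" using \<open>s > 0\<close> by (simp add: s_def flip: sum_divide_distrib)
    finally have "y' \<in> S" by (simp add: S_def y'_def)
    then have "quad_form G y' \<le> r" unfolding r_def by (rule x0(2))
    moreover have "quad_form G y' = quad_form G (\<lambda>u. (1 / sqrt s) * y u)"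
      by (intro quad_form_cong) (simp add: y'_def)
    ultimately have "quad_form G y / s \<le> r"
      using \<open>s > 0\<close> by (simp only: quad_form_scale) (simp add: power_divide)
    then show ?thesis using \<open>s > 0\<close> by (simp add: s_def pos_divide_le_eq)
  qed
  define x where "x u = \<bar>x0 u\<bar>" for u
  have nx: "(\<Sum>u\<in>?V. (x u)\<^sup>2) = 1" using x0(1) by (simp add: x_def S_def)
  have "r \<le> quad_form G x"
    unfolding r_def quad_form_def x_def
  proof (intro sum_mono)
    fix u
    have "x0 u * (\<Sum>v\<in>nbrs G u. x0 v) \<le> \<bar>x0 u\<bar> * \<bar>\<Sum>v\<in>nbrs G u. x0 v\<bar>"
      by (metis abs_ge_self abs_mult)
    also have "\<dots> \<le> \<bar>x0 u\<bar> * (\<Sum>v\<in>nbrs G u. \<bar>x0 v\<bar>)" by (intro mult_left_mono sum_abs) auto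
    finally show "x0 u * (\<Sum>v\<in>nbrs G u. x0 v) \<le> \<bar>x0 u\<bar> * (\<Sum>v\<in>nbrs G u. \<bar>x0 v\<bar>)" .
  qed
  then have Qx: "quad_form G x = r" using ray[of x] nx by simp
  have eig: "(\<Sum>v\<in>nbrs G u. x v) = r * x u" if u: "u \<in> ?V" for u
  proof -
    define z where "z v = (if v = u then 1 else 0 :: real)" for v
    have zsum: "(\<Sum>v\<in>?V. z v * g v) = g u" for g
      using u facts(1) by (simp add: z_def if_distrib[of "\<lambda>t. t * _"] sum.delta cong: if_cong)
    have z2: "(\<Sum>v\<in>?V. (z v)\<^sup>2) = 1"
      using zsum[of z] by (simp add: power2_eq_square z_def)
    \<comment> \<open>The maximizer is perturbed by \<open>t\<close> in the single coordinate
      \<open>u\<close>.\<close>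
    have "2 * t * ((\<Sum>v\<in>nbrs G u. x v) - r * x u) + t\<^sup>2 * (quad_form G z - r) \<le> 0" for t
    proof -
      have "(\<Sum>v\<in>?V. (x v + t * z v)\<^sup>2) =
          (\<Sum>v\<in>?V. (x v)\<^sup>2) + 2 * t * (\<Sum>v\<in>?V. z v * x v) + t\<^sup>2 * (\<Sum>v\<in>?V. (z v)\<^sup>2)"
        by (simp add: power2_sum sum.distrib sum_distrib_left power_mult_distrib mult_ac)
      also have "\<dots> = 1 + 2 * t * x u + t\<^sup>2" using nx zsum[of x] z2 by simp
      finally have "quad_form G x + 2 * t * (\<Sum>v\<in>nbrs G u. x v) + t\<^sup>2 * quad_form G z
          \<le> r * (1 + 2 * t * x u + t\<^sup>2)"
        using ray[of "\<lambda>v. x v + t * z v"] by (simp add: quad_form_add_scaled[OF G] zsum)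
      then show ?thesis using Qx by (simp add: algebra_simps)
    qed
    from linear_dominated_by_square[OF this] show ?thesis by simp
  qed
  have xnz: "\<exists>u\<in>?V. x u \<noteq> 0"
  proof (rule ccontr)
    assume "\<not> ?thesis"
    then show False using nx by simp
  qed
  let ?E = "{k. eigenvalue (adjacency_matrix G) k}"
  note ev = eigenvalue_adjacency_matrix_iff[OF facts(1), folded nbrs_def]
  have "r \<in> ?E" using ev eig xnz by blast
  moreover have "k \<le> r" if "k \<in> ?E" for k
  proof -
    have "eigenvalue (adjacency_matrix G) k" using that by simp
    then obtain y where y: "\<exists>u\<in>?V. y u \<noteq> 0" "\<forall>u\<in>?V. (\<Sum>v\<in>nbrs G u. y v) = k * y u"
      unfolding ev by blast
    define s where "s = (\<Sum>u\<in>?V. (y u)\<^sup>2)"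
    have "s > 0" using y(1) facts(1) unfolding s_def by (intro sum_squares_pos) auto
    have "quad_form G y = (\<Sum>u\<in>?V. y u * (k * y u))"
      unfolding quad_form_def using y(2) by (intro sum.cong) auto
    also have "\<dots> = k * s" unfolding s_def by (simp add: sum_distrib_left power2_eq_square mult_ac)
    finally have "k * s \<le> r * s" using ray[of y] by (simp add: s_def)
    then show "k \<le> r" using \<open>s > 0\<close> by simp
  qed
  moreover have "finite ?E"
    using card_finite_spectrum(1)[of "adjacency_matrix G" "length (vertex_list G)"]
    by (simp add: spectrum_def adjacency_matrix_def Let_def)
  ultimately have "graph_spectral_radius G = r"
    unfolding graph_spectral_radius_def by (intro Max_eqI) auto
  then show thesis using that[of x] eig xnz ray by (simp add: x_def)
qed

section \<open>Degrees and upper bounds for the spectral radius\<close>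

lemma finite_nbrs [simp]: "pair_graph G \<Longrightarrow> finite (nbrs G u)"
  by (simp add: nbrs_def pair_graph_facts(1))

lemma out_degree_eq_card_nbrs:
  assumes "pair_graph G"
  shows "out_degree (with_proj G) u = card (nbrs G u)"
proof -
  have "out_arcs (with_proj G) u = (\<lambda>v. (u, v)) ` nbrs G u"
    using pair_graph_facts(4)[OF assms] by (auto simp: out_arcs_def nbrs_def)
  moreover have "inj_on (\<lambda>v. (u, v)) (nbrs G u)" by (auto intro: inj_onI)
  ultimately show ?thesis by (simp add: out_degree_def card_image)
qed

lemma min_degree_le:
  assumes "pair_graph G" "u \<in> pverts G"
  shows "min_degree G \<le> card (nbrs G u)"
  unfolding min_degree_def out_degree_eq_card_nbrs[OF assms(1), symmetric]
  using pair_graph_facts(1)[OF assms(1)] assms(2) by (intro Min_le) auto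

lemma quad_form_arcs:
  assumes "pair_graph G"
  shows "quad_form G x = (\<Sum>(u, v)\<in>parcs G. x u * x v)"
proof -
  note facts = pair_graph_facts[OF assms]
  have "quad_form G x = (\<Sum>(u, v)\<in>(SIGMA u:pverts G. nbrs G u). x u * x v)"
    unfolding quad_form_def sum_distrib_left
    using facts(1) assms by (intro sum.Sigma) auto
  also have "(SIGMA u:pverts G. nbrs G u) = parcs G"
    using facts(3,4) by (auto simp: nbrs_def)
  finally show ?thesis .
qed

lemma rayleigh_quotient_le:
  assumes "pair_graph G" "pverts G \<noteq> {}"
  shows "quad_form G y \<le> graph_spectral_radius G * (\<Sum>u\<in>pverts G. (y u)\<^sup>2)"
  by (rule perron_vector[OF assms]) blast

lemma card_nbrs_eq_incident:
  assumes "pair_graph G" and u: "u \<in> pverts G"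
  shows "card (nbrs G u) = card {e \<in> edge_set G. u \<in> e}"
proof -
  note facts = pair_graph_facts[OF assms(1)] and E = edge_set_facts[OF assms(1)]
  have "bij_betw (\<lambda>v. {u, v}) (nbrs G u) {e \<in> edge_set G. u \<in> e}"
  proof (rule bij_betw_imageI)
    show "inj_on (\<lambda>v. {u, v}) (nbrs G u)" by (auto intro!: inj_onI simp: doubleton_eq_iff)
    show "(\<lambda>v. {u, v}) ` nbrs G u = {e \<in> edge_set G. u \<in> e}"
    proof (intro equalityI subsetI)
      fix e assume "e \<in> (\<lambda>v. {u, v}) ` nbrs G u"
      then show "e \<in> {e \<in> edge_set G. u \<in> e}" using E(4) by (auto simp: nbrs_def)
    next
      fix e assume e: "e \<in> {e \<in> edge_set G. u \<in> e}"
      then have "card e = 2" using E(3) by blast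
      then obtain v where v: "e = {u, v}" using e by (auto simp: card_2_iff)
      then show "e \<in> (\<lambda>v. {u, v}) ` nbrs G u" using e E(4)[of u v] facts(4) by (auto simp: nbrs_def)
    qed
  qed
  then show ?thesis by (rule bij_betw_same_card)
qed

lemma handshake:
  assumes "pair_graph G"
  shows "(\<Sum>u\<in>pverts G. card (nbrs G u)) = 2 * card (edge_set G)"
proof -
  note facts = pair_graph_facts[OF assms] and E = edge_set_facts[OF assms]
  have "(\<Sum>u\<in>pverts G. card (nbrs G u)) = (\<Sum>u\<in>pverts G. card {e \<in> edge_set G. u \<in> e})"
    by (intro sum.cong) (auto simp: card_nbrs_eq_incident[OF assms])
  also have "\<dots> = (\<Sum>e\<in>edge_set G. card {u \<in> pverts G. u \<in> e})"
    using sum.swap_restrict[OF facts(1) E(1), of "\<lambda>_ _. 1 :: nat" "\<lambda>v e. v \<in> e"] by simp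
  also have "\<dots> = (\<Sum>e\<in>edge_set G. 2)"
  proof (intro sum.cong refl)
    fix e assume e: "e \<in> edge_set G"
    then have "{u \<in> pverts G. u \<in> e} = e" using E(2) by blast
    then show "card {u \<in> pverts G. u \<in> e} = 2" using E(3)[OF e] by simp
  qed
  finally show ?thesis by simp
qed

text \<open>Summed over all vertices, the eigenvalue equations say that the spectral radius is the
  average of the degrees weighted by the Perron vector.\<close>

lemma spectral_radius_le_max_degree:
  assumes G: "pair_graph G" "pverts G \<noteq> {}" and D: "\<And>u. u \<in> pverts G \<Longrightarrow> card (nbrs G u) \<le> D"
  shows "graph_spectral_radius G \<le> real D"
proof -
  obtain x where x: "\<And>u. u \<in> pverts G \<Longrightarrow> 0 \<le> x u" "\<exists>u\<in>pverts G. x u \<noteq> 0"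
    "\<And>u. u \<in> pverts G \<Longrightarrow> (\<Sum>v\<in>nbrs G u. x v) = graph_spectral_radius G * x u"
    using perron_vector[OF G] by metis
  obtain u where u: "u \<in> pverts G" "x u \<noteq> 0" using x(2) by blast
  then have "0 < (\<Sum>u\<in>pverts G. x u)"
    using x(1)[OF u(1)] x(1) by (intro sum_pos2[OF pair_graph_facts(1)[OF G(1)] u(1)]) (auto simp: less_le)
  moreover have "graph_spectral_radius G * (\<Sum>u\<in>pverts G. x u) = (\<Sum>u\<in>pverts G. 1 * (\<Sum>v\<in>nbrs G u. x v))"
    using x(3) by (simp add: sum_distrib_left)
  moreover have "\<dots> = (\<Sum>v\<in>pverts G. x v * real (card (nbrs G v)))"
    using sum_nbrs_swap[OF G(1), of "\<lambda>_. 1" x] by simp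
  moreover have "\<dots> \<le> (\<Sum>v\<in>pverts G. x v * real D)"
    using x(1) D by (intro sum_mono mult_left_mono) auto
  moreover have "\<dots> = real D * (\<Sum>u\<in>pverts G. x u)" by (simp add: sum_distrib_left mult.commute)
  ultimately show ?thesis by (metis mult_le_cancel_right_pos)
qed

text \<open>The bound of Hong, Shu and Fang: the row sums of \<open>A\<^sup>2 - (\<delta> - 1) A\<close> are at most
  \<open>2 m - \<delta> (n - 1)\<close>.\<close>

lemma spectral_radius_edge_bound:
  assumes G: "pair_graph G" "pverts G \<noteq> {}"
    and \<delta>: "\<And>u. u \<in> pverts G \<Longrightarrow> \<delta> \<le> card (nbrs G u)"
  shows "(graph_spectral_radius G)\<^sup>2 - (real \<delta> - 1) * graph_spectral_radius G \<le>
    2 * real (card (edge_set G)) - real \<delta> * (real (card (pverts G)) - 1)"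
proof -
  let ?V = "pverts G" and ?r = "graph_spectral_radius G" and ?d = "\<lambda>u. real (card (nbrs G u))"
  note V = pair_graph_facts(1)[OF G(1)]
  define K where "K = 2 * real (card (edge_set G)) - real \<delta> * (real (card ?V) - 1)"
  obtain x where x: "\<And>u. u \<in> ?V \<Longrightarrow> 0 \<le> x u" "\<exists>u\<in>?V. x u \<noteq> 0"
    "\<And>u. u \<in> ?V \<Longrightarrow> (\<Sum>v\<in>nbrs G u. x v) = ?r * x u"
    using perron_vector[OF G] by metis
  define X where "X = (\<Sum>u\<in>?V. x u)"
  obtain u where u: "u \<in> ?V" "x u \<noteq> 0" using x(2) by blast
  then have "0 < X" unfolding X_def
    using x(1)[OF u(1)] x(1) by (intro sum_pos2[OF V u(1)]) (auto simp: less_le)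
  have 1: "(\<Sum>v\<in>?V. x v * ?d v) = ?r * X"
    using sum_nbrs_swap[OF G(1), of "\<lambda>_. 1" x] x(3) by (simp add: X_def sum_distrib_left)
  have "(\<Sum>w\<in>?V. x w * (\<Sum>v\<in>nbrs G w. ?d v)) = (\<Sum>v\<in>?V. ?d v * (\<Sum>w\<in>nbrs G v. x w))"
    by (rule sum_nbrs_swap[OF G(1)])
  also have "\<dots> = ?r * (\<Sum>v\<in>?V. x v * ?d v)"
    using x(3) by (simp add: sum_distrib_left mult_ac)
  finally have 2: "(\<Sum>w\<in>?V. x w * (\<Sum>v\<in>nbrs G w. ?d v)) = ?r\<^sup>2 * X"
    by (simp add: 1 power2_eq_square)
  \<comment> \<open>The degrees of the neighbours of \<open>w\<close> sum to twice the number of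
    edges minus the degree of \<open>w\<close> and the degrees of the non-neighbours, of which there
    are n - 1 - \<open>?d w\<close>, each of degree at least \<delta>.\<close>
  have row: "(\<Sum>v\<in>nbrs G w. ?d v) - (real \<delta> - 1) * ?d w \<le> K" if w: "w \<in> ?V" for w
  proof -
    let ?R = "?V - nbrs G w - {w}"
    have nw: "nbrs G w \<subseteq> ?V - {w}"
      using pair_graph_facts(6)[OF G(1)] by (auto simp: nbrs_def)
    have "card (nbrs G w \<union> ?R) = card (nbrs G w) + card ?R"
      using V G(1) by (intro card_Un_disjoint) auto
    moreover have "nbrs G w \<union> ?R = ?V - {w}" using nw by auto
    moreover have "card ?V = Suc (card (?V - {w}))" using w V by (intro card.remove) auto
    ultimately have cR: "real (card ?R) = real (card ?V) - 1 - ?d w" by simp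
    have "2 * real (card (edge_set G)) = (\<Sum>v\<in>?V. ?d v)"
      using handshake[OF G(1)] by (metis of_nat_mult of_nat_numeral of_nat_sum)
    also have "\<dots> = ?d w + (\<Sum>v\<in>?V - {w}. ?d v)" using w V by (rule sum.remove[rotated])
    also have "(\<Sum>v\<in>?V - {w}. ?d v) = (\<Sum>v\<in>?V - {w} - nbrs G w. ?d v) + (\<Sum>v\<in>nbrs G w. ?d v)"
      using nw V by (intro sum.subset_diff) auto
    also have "?V - {w} - nbrs G w = ?R" by auto
    finally have "2 * real (card (edge_set G)) = ?d w + ((\<Sum>v\<in>?R. ?d v) + (\<Sum>v\<in>nbrs G w. ?d v))" .
    moreover have "(\<Sum>v\<in>?R. real \<delta>) \<le> (\<Sum>v\<in>?R. ?d v)" using \<delta> by (intro sum_mono) auto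
    ultimately show ?thesis unfolding K_def by (simp add: cR algebra_simps)
  qed
  have "(?r\<^sup>2 - (real \<delta> - 1) * ?r) * X =
      (\<Sum>w\<in>?V. x w * ((\<Sum>v\<in>nbrs G w. ?d v) - (real \<delta> - 1) * ?d w))"
    using 1 2 by (simp add: right_diff_distrib left_diff_distrib sum_subtractf mult.left_commute
        flip: sum_distrib_left)
  also have "\<dots> \<le> (\<Sum>w\<in>?V. x w * K)" using x(1) row by (intro sum_mono mult_left_mono) auto
  also have "\<dots> = K * X" by (simp add: X_def sum_distrib_left mult.commute)
  finally show ?thesis using \<open>0 < X\<close> by (simp add: K_def)
qed

section \<open>Connectivity and strict monotonicity of the spectral radius\<close>

lemma cut_arc:
  assumes G: "pair_graph G" and conn: "k_vertex_connected k G" and X: "X \<subseteq> pverts G" "card X < k"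
    and S: "S \<subseteq> pverts G - X" "S \<noteq> {}" "S \<noteq> pverts G - X"
  shows "\<exists>u\<in>S. \<exists>v\<in>pverts G - X - S. (u, v) \<in> parcs G"
proof -
  let ?W = "pverts G - X"
  obtain a b where a: "a \<in> S" and b: "b \<in> ?W" "b \<notin> S" using S by blast
  \<comment> \<open>Connectedness is strong connectedness of the symmetric closure. The arcs of
    \<open>G\<close> are symmetric, so a walk in \<open>?H\<close> that leaves \<open>S\<close>
    yields an arc of \<open>G\<close>.\<close>
  let ?H = "mk_symmetric (with_proj G \<restriction> ?W)"
  have "Digraph_Component.connected (with_proj G \<restriction> ?W)"
    using conn X by (auto simp: k_vertex_connected_def)
  then have "a \<rightarrow>\<^sup>*\<^bsub>with_proj ?H\<^esub> b"
    using a b S(1) by (auto simp: Digraph_Component.connected_def strongly_connected_def mk_symmetric_def)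
  then have "(a, b) \<in> rtrancl_on (pverts ?H) (parcs ?H)" by (simp add: reachable_def)
  moreover have "\<exists>u\<in>S. \<exists>v\<in>?W - S. (u, v) \<in> parcs G"
    if "(a, c) \<in> rtrancl_on (pverts ?H) (parcs ?H)" "c \<notin> S" for c
    using that
  proof (induction rule: rtrancl_on_induct)
    case base
    then show ?case using a by blast
  next
    case (step y z)
    show ?case
    proof (cases "y \<in> S")
      case True
      have "(y, z) \<in> parcs ?H" using step by blast
      then have "(y, z) \<in> parcs G" "z \<in> ?W"
        using pair_graph_facts(5)[OF G] by (auto simp: mk_symmetric_def induce_subgraph_def)
      then show ?thesis using True step by blast
    next
      case False
      then show ?thesis using step by blast
    qed
  qed
  ultimately show ?thesis using b by blast
qed

text \<open>Connectedness makes the Perron vector positive everywhere. Moved to \<open>H\<close>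
  along \<open>f\<close>, it gains a positive term from every arc of \<open>H\<close> that is not an
  image, which would make the spectral radius of \<open>H\<close> strictly larger.\<close>

lemma spectral_radius_strict_mono:
  assumes G: "pair_graph G" and conn: "k_vertex_connected k G" "0 < k" and H: "pair_graph H"
    and f: "bij_betw f (pverts G) (pverts H)"
    and sub: "\<And>u v. (u, v) \<in> parcs G \<Longrightarrow> (f u, f v) \<in> parcs H"
    and le: "graph_spectral_radius H \<le> graph_spectral_radius G"
  shows "parcs H = (\<lambda>(u, v). (f u, f v)) ` parcs G"
proof (rule ccontr)
  assume neq: "parcs H \<noteq> (\<lambda>(u, v). (f u, f v)) ` parcs G"
  let ?r = "graph_spectral_radius G" and ?F = "\<lambda>(u, v). (f u, f v)"
  have ne: "pverts G \<noteq> {}" using conn by (auto simp: k_vertex_connected_def)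
  then have neH: "pverts H \<noteq> {}" using f by (auto simp: bij_betw_def)
  note fG = pair_graph_facts[OF G] and fH = pair_graph_facts[OF H]
  obtain x where x: "\<And>u. u \<in> pverts G \<Longrightarrow> 0 \<le> x u" "\<exists>u\<in>pverts G. x u \<noteq> 0"
    "\<And>u. u \<in> pverts G \<Longrightarrow> (\<Sum>v\<in>nbrs G u. x v) = ?r * x u"
    using perron_vector[OF G ne] by metis
  have pos: "0 < x u" if u: "u \<in> pverts G" for u
  proof (rule ccontr)
    assume "\<not> 0 < x u"
    then have "x u = 0" using x(1)[OF u] by simp
    \<comment> \<open>The neighbours of a zero have entries that are nonnegative and sum to 0, so no
      arc leaves the zero set.\<close>
    define S where "S = {v \<in> pverts G. x v = 0}"
    have "\<exists>v\<in>S. \<exists>w\<in>pverts G - {} - S. (v, w) \<in> parcs G"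
      using x(2) u \<open>x u = 0\<close> conn(2) by (intro cut_arc[OF G conn(1)]) (auto simp: S_def)
    then obtain v w where vw: "v \<in> S" "w \<in> pverts G" "w \<notin> S" "(v, w) \<in> parcs G" by blast
    then have "(\<Sum>w\<in>nbrs G v. x w) = 0" using x(3)[of v] by (simp add: S_def)
    moreover have "\<And>w. w \<in> nbrs G v \<Longrightarrow> 0 \<le> x w" using x(1) by (simp add: nbrs_def)
    ultimately have "\<forall>w\<in>nbrs G v. x w = 0"
      using sum_nonneg_eq_0_iff[of "nbrs G v" x] G by simp
    then show False using vw by (auto simp: nbrs_def S_def)
  qed
  define g where "g = the_inv_into (pverts G) f"
  have g: "g (f u) = u" if "u \<in> pverts G" for u
    using that f by (simp add: g_def the_inv_into_f_f bij_betw_def)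
  have gin: "g w \<in> pverts G" if "w \<in> pverts H" for w
    using that f by (auto simp: g_def bij_betw_def the_inv_into_into)
  define y where "y w = x (g w)" for w
  have "inj_on ?F (parcs G)"
    using f fG(3,4) by (auto intro!: inj_onI simp: bij_betw_def dest: inj_onD)
  then have "quad_form G x = (\<Sum>(u, v)\<in>?F ` parcs G. y u * y v)"
    unfolding quad_form_arcs[OF G] using fG(3,4)
    by (subst sum.reindex) (auto intro!: sum.cong simp: y_def g)
  also have "\<dots> < (\<Sum>(u, v)\<in>parcs H. y u * y v)"
  proof -
    have "?F ` parcs G \<subseteq> parcs H" using sub by auto
    then obtain a b where ab: "(a, b) \<in> parcs H - ?F ` parcs G" using neq by auto
    show ?thesis
    proof (rule sum_strict_mono2[OF fH(2) _ ab])
      show "?F ` parcs G \<subseteq> parcs H" by fact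
      show "0 < (case (a, b) of (u, v) \<Rightarrow> y u * y v)"
        using ab fH(3,4) gin pos by (auto simp: y_def)
      show "0 \<le> (case e of (u, v) \<Rightarrow> y u * y v)" if "e \<in> parcs H" for e
        using that by (cases e) (auto simp: y_def intro!: mult_nonneg_nonneg x(1) gin dest: fH(3,4))
    qed
  qed
  also have "\<dots> = quad_form H y" by (simp add: quad_form_arcs[OF H])
  also have "\<dots> \<le> graph_spectral_radius H * (\<Sum>w\<in>pverts H. (y w)\<^sup>2)"
    by (rule rayleigh_quotient_le[OF H neH])
  also have "(\<Sum>w\<in>pverts H. (y w)\<^sup>2) = (\<Sum>u\<in>pverts G. (y (f u))\<^sup>2)"
    by (rule sum.reindex_bij_betw[OF f, symmetric])
  also have "\<dots> = (\<Sum>u\<in>pverts G. (x u)\<^sup>2)" by (intro sum.cong) (auto simp: y_def g)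
  also have "graph_spectral_radius H * \<dots> \<le> ?r * \<dots>"
    using le by (intro mult_right_mono sum_nonneg) auto
  also have "\<dots> = quad_form G x"
    unfolding quad_form_def using x(3) by (simp add: sum_distrib_left power2_eq_square mult_ac)
  finally show False by simp
qed

lemma B_graph_spectral_radius_gt:
  assumes n1: "2 \<le> n1" "n1 + 2 \<le> n"
  shows "real (n - n1) - 1 < graph_spectral_radius (B_graph n n1 2)"
proof (rule ccontr)
  let ?B = "B_graph n n1 2" and ?r = "graph_spectral_radius (B_graph n n1 2)"
  assume "\<not> ?thesis"
  then have r: "?r \<le> real (n - n1) - 1" by simp
  have B: "pair_graph ?B" using n1 by (intro pair_graph_B_graph) auto
  have V: "pverts ?B = {..<n}" by (simp add: B_graph_def)
  define N where "N = real (n - n1)"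
  have N: "N > 0" using n1 by (simp add: N_def)
  \<comment> \<open>The complete graph on N vertices alone gives N - 1. The weight 1 / N at one
    further end of a matching edge adds 2 / N to the form, but only (N - 1) / N^2 to N - 1 times the
    squared norm.\<close>
  define x where "x v = (if n1 \<le> v then 1 else if v = 0 then 1 / N else 0)" for v
  define P where "P = {n1..<n} \<times> {n1..<n} - (\<lambda>v. (v, v)) ` {n1..<n}"
  have "card P = (n - n1) * (n - n1) - (n - n1)"
    unfolding P_def by (subst card_Diff_subset) (auto simp: card_cartesian_product card_image inj_on_def)
  then have cP: "real (card P) = N * N - N"
    by (simp add: N_def of_nat_diff[OF le_square])
  have P: "finite P" "(0, n1) \<notin> P" "(n1, 0) \<notin> P" using n1 by (auto simp: P_def)
  have "(\<Sum>(u, v)\<in>P. x u * x v) = (\<Sum>_\<in>P. 1)"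
    by (intro sum.cong) (auto simp: P_def x_def)
  then have "N * N - N + 2 / N = (\<Sum>(u, v)\<in>insert (0, n1) (insert (n1, 0) P). x u * x v)"
    using P n1 cP by (simp add: x_def)
  also have "\<dots> \<le> (\<Sum>(u, v)\<in>parcs ?B. x u * x v)"
  proof (rule sum_mono2)
    show "finite (parcs ?B)" by (rule pair_graph_facts(2)[OF B])
    show "insert (0, n1) (insert (n1, 0) P) \<subseteq> parcs ?B"
      using n1 by (force simp: B_graph_def P_def)
    show "\<And>e. 0 \<le> (case e of (u, v) \<Rightarrow> x u * x v)" using N by (auto simp: x_def)
  qed
  also have "\<dots> = quad_form ?B x" by (simp add: quad_form_arcs[OF B])
  also have "\<dots> \<le> ?r * (\<Sum>v\<in>pverts ?B. (x v)\<^sup>2)"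
    using n1 by (intro rayleigh_quotient_le[OF B]) (auto simp: V lessThan_empty_iff)
  also have "\<dots> \<le> (N - 1) * (\<Sum>v\<in>pverts ?B. (x v)\<^sup>2)"
    using r by (intro mult_right_mono sum_nonneg) (auto simp: N_def)
  also have "(\<Sum>v\<in>pverts ?B. (x v)\<^sup>2) = N + (1 / N)\<^sup>2"
  proof -
    have "(\<Sum>v\<in>pverts ?B. (x v)\<^sup>2) = (\<Sum>v\<in>insert 0 {n1..<n}. (x v)\<^sup>2)"
      unfolding V using n1 by (intro sum.mono_neutral_right) (auto simp: x_def)
    also have "\<dots> = (1 / N)\<^sup>2 + (\<Sum>v\<in>{n1..<n}. 1)"
      using n1 by (simp add: x_def)
    finally show ?thesis using n1 by (simp add: N_def)
  qed
  finally have "2 / N \<le> (N - 1) * (1 / N)\<^sup>2" by (simp add: algebra_simps)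
  then have "2 * N \<le> N - 1" using N by (simp add: field_simps power2_eq_square)
  then show False using N by simp
qed

section \<open>Extremal counting\<close>

text \<open>Doubled and over the integers, so that binomial coefficients become polynomials without
  division or truncated subtraction.\<close>

lemma card_edges_le_cover:
  assumes fin: "finite \<Y>" "\<And>X. X \<in> \<Y> \<Longrightarrow> finite X" and E: "\<And>e. e \<in> E \<Longrightarrow> card e = 2"
    and cover: "\<And>e. e \<in> E \<Longrightarrow> \<exists>X\<in>\<Y>. e \<subseteq> X"
  shows "2 * int (card E) \<le> (\<Sum>X\<in>\<Y>. int (card X) * (int (card X) - 1))"
proof -
  let ?P = "\<lambda>X. {e. e \<subseteq> X \<and> card e = 2}"
  have fP: "finite (?P X)" if "X \<in> \<Y>" for X
    using fin(2)[OF that] by (rule finite_subset[rotated, OF finite_Pow_iff[THEN iffD2]]) auto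
  have "E \<subseteq> (\<Union>X\<in>\<Y>. ?P X)" using E cover by blast
  then have "card E \<le> card (\<Union>X\<in>\<Y>. ?P X)" using fin(1) fP by (intro card_mono) auto
  also have "\<dots> \<le> (\<Sum>X\<in>\<Y>. card (?P X))" using fin(1) by (rule card_UN_le)
  finally have "2 * int (card E) \<le> (\<Sum>X\<in>\<Y>. 2 * int (card (?P X)))"
    by (simp flip: sum_distrib_left of_nat_sum)
  also have "\<dots> = (\<Sum>X\<in>\<Y>. int (card X) * (int (card X) - 1))"
  proof (intro sum.cong refl)
    fix X assume X: "X \<in> \<Y>"
    have "2 dvd card X * (card X - 1)" by (cases "card X") auto
    then have "2 * card (?P X) = card X * (card X - 1)"
      using n_subsets[OF fin(2)[OF X], of 2] by (simp add: choose_two)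
    then have "int (2 * card (?P X)) = int (card X * (card X - 1))" by (rule arg_cong)
    then show "2 * int (card (?P X)) = int (card X) * (int (card X) - 1)"
      by (cases "card X") (simp_all add: algebra_simps)
  qed
  finally show ?thesis .
qed

text \<open>Among sets with at most \<open>k\<close> elements, those with \<open>k\<close> elements
  have the most edges per unit of weight 2 * card X - 3.\<close>

lemma cover_edges_rank_ratio:
  assumes "finite \<Y>" and c: "\<And>X. X \<in> \<Y> \<Longrightarrow> 2 \<le> card X" "\<And>X. X \<in> \<Y> \<Longrightarrow> card X \<le> k"
  shows "(\<Sum>X\<in>\<Y>. int (card X) * (int (card X) - 1)) * (2 * int k - 3) \<le>
    int k * (int k - 1) * (\<Sum>X\<in>\<Y>. 2 * int (card X) - 3)"
proof -
  have "int (card X) * (int (card X) - 1) * (2 * int k - 3) \<le>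
      int k * (int k - 1) * (2 * int (card X) - 3)" if "X \<in> \<Y>" for X
  proof -
    define a b where "a = int (card X)" and "b = int k"
    have ab: "2 \<le> a" "a \<le> b" using c[OF that] by (simp_all add: a_def b_def)
    have "b * (b - 1) * (2 * a - 3) - a * (a - 1) * (2 * b - 3) =
        (b - a) * (2 * ((b - 2) * (a - 2)) + (b - 2) + (a - 2) - 1)"
      by (simp add: algebra_simps)
    also have "\<dots> \<ge> 0"
    proof (cases "a = b")
      case False
      \<comment> \<open>As a < b, the bracket is nonnegative despite its - 1; for sizes 2 and 3 it
        is 0 and the two ratios agree.\<close>
      then have "1 \<le> (b - 2) + (a - 2)" "0 \<le> (b - 2) * (a - 2)" using ab by simp_all
      then have "0 \<le> 2 * ((b - 2) * (a - 2)) + (b - 2) + (a - 2) - 1" by linarith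
      moreover have "0 \<le> b - a" using ab by simp
      ultimately show ?thesis by (rule mult_nonneg_nonneg[rotated])
    qed simp
    finally show ?thesis by (simp add: a_def b_def)
  qed
  then show ?thesis
    unfolding sum_distrib_right sum_distrib_left by (intro sum_mono) auto
qed

lemma bij_betw_two_points:
  assumes "finite A" "finite B" "card A = card B" "{a, a'} \<subseteq> A" "a \<noteq> a'" "{b, b'} \<subseteq> B" "b \<noteq> b'"
  shows "\<exists>f. bij_betw f A B \<and> f a = b \<and> f a' = b'"
proof -
  have "card (A - {a, a'}) = card (B - {b, b'})"
    using assms by (simp add: card_Diff_subset)
  then obtain g where g: "bij_betw g (A - {a, a'}) (B - {b, b'})"
    using assms(1,2) by (meson finite_Diff finite_same_card_bij)
  define f where "f x = (if x = a then b else if x = a' then b' else g x)" for x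
  have "bij_betw f ({a, a'} \<union> (A - {a, a'})) ({b, b'} \<union> (B - {b, b'}))"
  proof (rule bij_betw_combine)
    show "bij_betw f {a, a'} {b, b'}" using assms(5,7) by (auto simp: f_def bij_betw_def)
    show "bij_betw f (A - {a, a'}) (B - {b, b'})"
      using g by (rule bij_betw_cong[THEN iffD1, rotated]) (auto simp: f_def)
  qed auto
  moreover have "{a, a'} \<union> (A - {a, a'}) = A" "{b, b'} \<union> (B - {b, b'}) = B" using assms by auto
  ultimately show ?thesis using assms(5) by (intro exI[of _ f]) (auto simp: f_def)
qed

lemma digraph_iso_pairI:
  assumes G: "pair_graph G" and f: "bij_betw f (pverts G) (pverts H)"
    and arcs: "parcs H = (\<lambda>(u, v). (f u, f v)) ` parcs G"
  shows "digraph_iso (with_proj G) (with_proj H)"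
proof -
  interpret pair_graph G by fact
  let ?h = "\<lparr>iso_verts = f, iso_arcs = (\<lambda>(u, v). (f u, f v)), iso_head = snd, iso_tail = fst\<rparr>"
  have "inj_on (\<lambda>(u, v). (f u, f v)) (parcs G)"
    using f pair_graph_facts(3,4)[OF G] by (auto intro!: inj_onI simp: bij_betw_def dest: inj_onD)
  then have "pre_digraph.digraph_isomorphism (with_proj G) ?h"
    using f wf_digraph_axioms by (auto simp: pre_digraph.digraph_isomorphism_def bij_betw_def)
  moreover have "with_proj H = app_iso ?h (with_proj G)"
    using f arcs by (simp add: app_iso_def with_proj_def bij_betw_def)
  ultimately show ?thesis unfolding digraph_iso_def by blast
qed

text \<open>The weight \<open>2 * card X - 3\<close> left over by a largest member \<open>X\<close> of the cover is just too small
  for the remaining edges, unless a second member fills the complement of \<open>X\<close> and only two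
  weights \<open>1\<close>, that is two edges, are left.\<close>

lemma cover_dichotomy:
  fixes G :: "'a pair_pre_digraph" and \<delta> :: nat
  defines "n \<equiv> card (pverts G)"
  assumes G: "pair_graph G" and conn: "k_vertex_connected 2 G"
    and \<delta>: "\<And>u. u \<in> pverts G \<Longrightarrow> \<delta> \<le> card (nbrs G u)" "6 \<le> \<delta>" and n: "2 * \<delta> + 4 \<le> n"
    and m: "(int n - int \<delta> - 1) * (int n - int \<delta> - 2) + int \<delta> * (int \<delta> + 1) < 2 * int (card (edge_set G))"
    and \<X>: "finite \<X>" "\<And>X. X \<in> \<X> \<Longrightarrow> X \<subseteq> pverts G" "\<And>X. X \<in> \<X> \<Longrightarrow> 2 \<le> card X"
      "\<And>X Y. X \<in> \<X> \<Longrightarrow> Y \<in> \<X> \<Longrightarrow> X \<noteq> Y \<Longrightarrow> card (X \<inter> Y) \<le> 1"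
      "\<And>e. e \<in> edge_set G \<Longrightarrow> \<exists>X\<in>\<X>. e \<subseteq> X"
      "(\<Sum>X\<in>\<X>. 2 * card X - 3) + 4 \<le> 2 * n"
  obtains X Z \<Z> where "X \<union> Z = pverts G" "X \<inter> Z = {}"
    "card Z = \<delta> + 1 \<or> card Z = \<delta> + 2 \<and> card X = \<delta> + 2" "3 \<le> card X"
    "finite \<Z>" "card \<Z> \<le> 2" "\<And>e. e \<in> edge_set G \<Longrightarrow> e \<subseteq> X \<or> e \<subseteq> Z \<or> e \<in> \<Z>"
proof -
  let ?V = "pverts G" and ?E = "edge_set G"
  note V = pair_graph_facts(1)[OF G] and E = edge_set_facts[OF G]
  define w where "w X = 2 * int (card X) - 3" for X :: "'a set"
  define c where "c X = int (card X) * (int (card X) - 1)" for X :: "'a set"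
  have fX: "finite X" if "X \<in> \<X>" for X using \<X>(2)[OF that] V finite_subset by blast
  have w1: "1 \<le> w X" if "X \<in> \<X>" for X using \<X>(3)[OF that] by (simp add: w_def)
  have "w X = int (2 * card X - 3)" if "X \<in> \<X>" for X
    using \<X>(3)[OF that] by (simp add: w_def of_nat_diff)
  then have "(\<Sum>X\<in>\<X>. w X) = int (\<Sum>X\<in>\<X>. 2 * card X - 3)"
    unfolding of_nat_sum by (intro sum.cong) auto
  then have W: "(\<Sum>X\<in>\<X>. w X) \<le> 2 * int n - 4" using \<X>(6) by linarith
  have mX: "2 * int (card ?E) \<le> (\<Sum>X\<in>\<X>. c X)"
    unfolding c_def using \<X>(1,5) fX E(3) by (intro card_edges_le_cover) auto
  have big: "\<exists>X\<in>\<X>. \<delta> + 2 \<le> card X"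
  proof (rule ccontr)
    assume "\<not> ?thesis"
    then have "card X \<le> \<delta> + 1" if "X \<in> \<X>" for X using that by force
    then have "(\<Sum>X\<in>\<X>. c X) * (2 * int (\<delta> + 1) - 3) \<le> int (\<delta> + 1) * (int (\<delta> + 1) - 1) * (\<Sum>X\<in>\<X>. w X)"
      unfolding c_def w_def using \<X>(1,3) by (intro cover_edges_rank_ratio) auto
    also have "\<dots> \<le> int (\<delta> + 1) * (int (\<delta> + 1) - 1) * (2 * int n - 4)"
      using W by (intro mult_left_mono) auto
    finally have 1: "(\<Sum>X\<in>\<X>. c X) * (2 * int \<delta> - 1) \<le> (int \<delta> + 1) * int \<delta> * (2 * int n - 4)"
      by (simp add: algebra_simps)
    have "((int n - int \<delta> - 1) * (int n - int \<delta> - 2) + int \<delta> * (int \<delta> + 1)) * (2 * int \<delta> - 1)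
        < (\<Sum>X\<in>\<X>. c X) * (2 * int \<delta> - 1)"
      using m mX \<delta>(2) by (intro mult_strict_right_mono) auto
    with 1 have 2: "((int n - int \<delta> - 1) * (int n - int \<delta> - 2) + int \<delta> * (int \<delta> + 1)) * (2 * int \<delta> - 1)
        < (int \<delta> + 1) * int \<delta> * (2 * int n - 4)" by linarith
    \<comment> \<open>Measured from the smallest admissible \<delta> and n, the difference of the
      two sides is a polynomial with positive coefficients only.\<close>
    define d t where "d = int \<delta> - 6" and "t = int n - 2 * int \<delta> - 4"
    have dt: "0 \<le> d" "0 \<le> t" using \<delta>(2) n by (simp_all add: d_def t_def)
    have eqs: "int \<delta> = d + 6" "int n = 2 * d + 16 + t" by (simp_all add: d_def t_def)
    have "0 < (2 * d + 11) * t\<^sup>2 + (2 * d\<^sup>2 + 30 * d + 103) * t + (2 * d\<^sup>2 + 26 * d + 78)"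
      using dt by (intro add_nonneg_pos add_nonneg_nonneg mult_nonneg_nonneg) auto
    then show False using 2 unfolding eqs by (simp add: algebra_simps power2_eq_square)
  qed
  define s where "s = Max (card ` \<X>)"
  have ne: "card ` \<X> \<noteq> {}" "finite (card ` \<X>)" using big \<X>(1) by auto
  obtain X where X: "X \<in> \<X>" "card X = s" using Max_in[OF ne(2,1)] by (auto simp: s_def)
  have s_max: "card Z \<le> s" if "Z \<in> \<X>" for Z using that \<X>(1) by (simp add: s_def)
  have s_ge: "\<delta> + 2 \<le> s" using big s_max le_trans by blast
  define \<Y> where "\<Y> = \<X> - {X}"
  \<comment> \<open>The number of vertices outside \<open>X\<close>. The other members share the
    weight (2 n - 4) - (2 s - 3) = 2 y - 1.\<close>
  define y where "y = int n - int s"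
  have WY: "(\<Sum>Z\<in>\<Y>. w Z) \<le> 2 * y - 1"
    using W sum.remove[OF \<X>(1) X(1), of w] X(2) by (simp add: \<Y>_def w_def y_def)
  have finY: "finite \<Y>" using \<X>(1) by (simp add: \<Y>_def)
  have w0: "0 \<le> (\<Sum>Z\<in>\<Z>. w Z)" if "\<Z> \<subseteq> \<X>" for \<Z>
    using that w1 by (intro sum_nonneg) force
  have y1: "1 \<le> y" using WY w0[of \<Y>] by (auto simp: \<Y>_def)
  have cV: "card (?V - X) = n - s" using X \<X>(2) fX card_Diff_subset[of X ?V] by (simp add: n_def)
  have wZ: "w Z \<le> 2 * y - 1" if "Z \<in> \<Y>" for Z
  proof -
    have "w Z \<le> (\<Sum>Z\<in>\<Y>. w Z)" using that finY w1 by (intro member_le_sum) (force simp: \<Y>_def)+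
    then show ?thesis using WY by simp
  qed
  \<comment> \<open>The weight alone allows y + 1, as 2 * (y + 1) - 3 = 2 y - 1. Then
    \<open>X\<close> and \<open>Z\<close> would be the whole cover and would meet in one cut vertex,
    against 2-connectedness.\<close>
  have Zy: "int (card Z) \<le> y" if Z: "Z \<in> \<Y>" for Z
  proof (rule ccontr)
    assume "\<not> int (card Z) \<le> y"
    then have cZ: "int (card Z) = y + 1" using wZ[OF Z] by (simp add: w_def)
    have Z': "Z \<in> \<X>" "Z \<noteq> X" using Z by (auto simp: \<Y>_def)
    have "\<Y> - {Z} = {}"
    proof (rule ccontr)
      assume "\<Y> - {Z} \<noteq> {}"
      then obtain U where U: "U \<in> \<Y> - {Z}" by blast
      have "w U \<le> (\<Sum>Z\<in>\<Y> - {Z}. w Z)" using U finY w1 by (intro member_le_sum) (force simp: \<Y>_def)+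
      moreover have "(\<Sum>Z\<in>\<Y>. w Z) = w Z + (\<Sum>Z\<in>\<Y> - {Z}. w Z)" by (rule sum.remove[OF finY Z])
      ultimately show False using WY w1[of U] U cZ by (auto simp: \<Y>_def w_def)
    qed
    then have only: "\<X> = {X, Z}" using X(1) Z by (auto simp: \<Y>_def)
    have "card (X \<union> Z) + card (X \<inter> Z) = s + card Z"
      using card_Un_Int[of X Z] fX X Z' by simp
    moreover have "card (X \<union> Z) \<le> n" unfolding n_def using \<X>(2) X(1) Z' V by (intro card_mono) auto
    moreover have "card (X \<inter> Z) \<le> 1" using \<X>(4) X(1) Z' by auto
    ultimately have cu: "card (X \<union> Z) = n" "card (X \<inter> Z) = 1"
      using cZ unfolding y_def by linarith+
    have XZ: "X \<union> Z = ?V"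
      using cu(1) \<X>(2) X(1) Z' V unfolding n_def by (intro card_subset_eq) auto
    obtain v where v: "X \<inter> Z = {v}" using cu(2) by (auto simp: card_1_singleton_iff)
    have "\<exists>a\<in>X - {v}. \<exists>b\<in>?V - {v} - (X - {v}). (a, b) \<in> parcs G"
    proof (rule cut_arc[OF G conn])
      show "{v} \<subseteq> ?V" "card {v} < 2" "X - {v} \<subseteq> ?V - {v}" using v XZ by auto
      show "X - {v} \<noteq> {}"
      proof
        assume "X - {v} = {}"
        then have "card X \<le> card {v}" by (intro card_mono) auto
        then show False using X(2) s_ge by simp
      qed
      show "X - {v} \<noteq> ?V - {v}"
      proof
        assume "X - {v} = ?V - {v}"
        then have "Z \<subseteq> {v}" using v XZ by auto
        then have "card Z \<le> card {v}" by (intro card_mono) auto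
        then show False using \<X>(3)[OF Z'(1)] by simp
      qed
    qed
    then obtain a b where ab: "a \<in> X - {v}" "b \<in> ?V - X" "(a, b) \<in> parcs G" by blast
    then have "{a, b} \<in> ?E" using E(4) by blast
    then have "{a, b} \<subseteq> X \<or> {a, b} \<subseteq> Z" using \<X>(5) only by blast
    then show False using ab v by blast
  qed
  define E2 where "E2 = {e \<in> ?E. \<not> e \<subseteq> X}"
  have E2: "2 * int (card E2) \<le> (\<Sum>Z\<in>\<Y>. c Z)"
    unfolding c_def
  proof (rule card_edges_le_cover[OF finY])
    show "finite U" if "U \<in> \<Y>" for U using that fX by (simp add: \<Y>_def)
    show "card e = 2" if "e \<in> E2" for e using that E(3) by (simp add: E2_def)
    show "\<exists>U\<in>\<Y>. e \<subseteq> U" if e: "e \<in> E2" for e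
    proof -
      obtain U where "U \<in> \<X>" "e \<subseteq> U" using \<X>(5)[of e] e by (auto simp: E2_def)
      then show ?thesis using e by (intro bexI[of _ U]) (auto simp: \<Y>_def E2_def)
    qed
  qed
  have m2: "2 * int (card ?E) \<le> int s * (int s - 1) + 2 * int (card E2)"
  proof -
    have "card ?E = card {e \<in> ?E. e \<subseteq> X} + card E2"
      using E(1) unfolding E2_def by (subst card_Un_disjoint[symmetric]) (auto intro: arg_cong[where f = card])
    moreover have "2 * int (card {e \<in> ?E. e \<subseteq> X}) \<le> (\<Sum>X\<in>{X}. int (card X) * (int (card X) - 1))"
      using fX[OF X(1)] E(3) by (intro card_edges_le_cover) auto
    ultimately show ?thesis using X(2) by simp
  qed
  \<comment> \<open>The degrees outside \<open>X\<close> count each edge of \<open>E2\<close> once,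
    and a second time if both ends are outside, which happens for at most y (y - 1) / 2
    edges.\<close>
  have deg: "int \<delta> * y * 2 \<le> 2 * int (card E2) + y * (y - 1)"
  proof -
    let ?Y = "?V - X"
    have fY: "finite ?Y" using V by simp
    have "\<delta> * card ?Y \<le> (\<Sum>u\<in>?Y. card (nbrs G u))"
      using \<delta>(1) sum_mono[of ?Y "\<lambda>_. \<delta>" "\<lambda>u. card (nbrs G u)"] by (simp add: mult.commute)
    also have "\<dots> = (\<Sum>u\<in>?Y. card {e \<in> E2. u \<in> e})"
    proof (intro sum.cong refl)
      fix u assume u: "u \<in> ?Y"
      then have "{e \<in> E2. u \<in> e} = {e \<in> ?E. u \<in> e}" by (auto simp: E2_def)
      then show "card (nbrs G u) = card {e \<in> E2. u \<in> e}"
        using card_nbrs_eq_incident[OF G] u by simp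
    qed
    also have "\<dots> = (\<Sum>e\<in>E2. card {u \<in> ?Y. u \<in> e})"
      using sum.swap_restrict[OF fY, of E2 "\<lambda>_ _. 1 :: nat" "\<lambda>v e. v \<in> e"] E(1) by (simp add: E2_def)
    also have "\<dots> \<le> (\<Sum>e\<in>E2. 1 + (if e \<subseteq> ?Y then 1 else 0))"
    proof (intro sum_mono)
      fix e assume e: "e \<in> E2"
      then have c2: "card e = 2" using E(3) by (auto simp: E2_def)
      then have fe: "finite e" by (metis card.infinite zero_neq_numeral)
      show "card {u \<in> ?Y. u \<in> e} \<le> 1 + (if e \<subseteq> ?Y then 1 else 0)"
      proof (cases "e \<subseteq> ?Y")
        case True
        have "card {u \<in> ?Y. u \<in> e} \<le> card e" using fe by (intro card_mono) auto
        then show ?thesis using True c2 by simp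
      next
        case False
        then have "{u \<in> ?Y. u \<in> e} \<subset> e" by blast
        then have "card {u \<in> ?Y. u \<in> e} < card e" using fe by (rule psubset_card_mono[rotated])
        then show ?thesis using c2 by simp
      qed
    qed
    also have "\<dots> = card E2 + card {e \<in> E2. e \<subseteq> ?Y}"
    proof -
      have "finite E2" using E(1) by (simp add: E2_def)
      then have "(\<Sum>e\<in>E2. if e \<subseteq> ?Y then 1 else 0) = card {e \<in> E2. e \<subseteq> ?Y}"
        using sum.inter_filter[of E2 "\<lambda>_. 1 :: nat" "\<lambda>e. e \<subseteq> ?Y"] by simp
      then show ?thesis by (simp only: sum.distrib) simp
    qed
    finally have "int (\<delta> * card ?Y) \<le> int (card E2 + card {e \<in> E2. e \<subseteq> ?Y})"
      by (simp only: of_nat_le_iff)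
    moreover have "2 * int (card {e \<in> E2. e \<subseteq> ?Y}) \<le> (\<Sum>X\<in>{?Y}. int (card X) * (int (card X) - 1))"
      using fY E(3) by (intro card_edges_le_cover) (auto simp: E2_def)
    moreover have cY: "int (card ?Y) = y" using cV y1 by (simp add: y_def)
    ultimately have "int \<delta> * y \<le> int (card E2) + int (card {e \<in> E2. e \<subseteq> ?Y})"
      "2 * int (card {e \<in> E2. e \<subseteq> ?Y}) \<le> y * (y - 1)" by simp_all
    then show ?thesis by linarith
  qed
  have ynat: "int (nat y) = y" using y1 by simp
  \<comment> \<open>For y \<ge> 2, the edge-weight ratio for sets of at most y elements and the
    degree bound give \<delta> (2 y - 3) \<le> 2 (y - 1)^2, which with y \<le> \<delta> leaves only
    y = 2, and then \<delta> is too large. For y = 1, where 2 y - 3 is negative, no further member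
    fits at all.\<close>
  have y_ge: "int \<delta> + 1 \<le> y"
  proof (rule ccontr)
    assume small: "\<not> int \<delta> + 1 \<le> y"
    have "(\<Sum>Z\<in>\<Y>. c Z) * (2 * int (nat y) - 3) \<le> int (nat y) * (int (nat y) - 1) * (\<Sum>Z\<in>\<Y>. w Z)"
      unfolding c_def w_def using \<X>(3) Zy finY by (intro cover_edges_rank_ratio) (force simp: \<Y>_def)+
    then have 1: "(\<Sum>Z\<in>\<Y>. c Z) * (2 * y - 3) \<le> y * (y - 1) * (\<Sum>Z\<in>\<Y>. w Z)" using ynat by simp
    show False
    proof (cases "y = 1")
      case True
      then have "\<Y> = {}" using Zy \<X>(3) by (force simp: \<Y>_def)
      then show False using True E2 deg \<delta>(2) by simp
    next
      case False
      then have y2: "2 \<le> y" using y1 by simp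
      have "2 * int (card E2) * (2 * y - 3) \<le> (\<Sum>Z\<in>\<Y>. c Z) * (2 * y - 3)"
        using E2 y2 by (intro mult_right_mono) auto
      also have "\<dots> \<le> y * (y - 1) * (2 * y - 1)"
        by (rule order_trans[OF 1]) (use WY y2 in \<open>intro mult_left_mono; simp\<close>)
      finally have "2 * int (card E2) * (2 * y - 3) \<le> y * (y - 1) * (2 * y - 1)" .
      moreover have "int \<delta> * y * 2 * (2 * y - 3) \<le> (2 * int (card E2) + y * (y - 1)) * (2 * y - 3)"
        using deg y2 by (intro mult_right_mono) auto
      ultimately have "y * (int \<delta> * (2 * y - 3)) \<le> y * (2 * (y - 1) * (y - 1))"
        by (simp add: algebra_simps)
      then have 2: "int \<delta> * (2 * y - 3) \<le> 2 * (y - 1) * (y - 1)" using y2 by simp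
      show False
      proof (cases "y = 2")
        case True
        then show False using 2 \<delta>(2) by simp
      next
        case False
        have "y * (2 * y - 3) \<le> int \<delta> * (2 * y - 3)" using small y2 by (intro mult_right_mono) auto
        then have "y * (2 * y - 3) \<le> 2 * (y - 1) * (y - 1)" using 2 by linarith
        then have "y \<le> 2" by (simp add: algebra_simps)
        then show False using False y2 by simp
      qed
    qed
  qed
  \<comment> \<open>The convexity of the edge count in exact form: the last term is twice what is
    lost by splitting n into s and y instead of n - \<delta> - 1 and \<delta> + 1.\<close>
  have ident: "(int n - int \<delta> - 1) * (int n - int \<delta> - 2) + int \<delta> * (int \<delta> + 1) =
      int s * (int s - 1) + y * (y - 1) + 2 * (int s - int \<delta> - 1) * (y - int \<delta> - 1)"
    unfolding y_def by (simp add: algebra_simps)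
  have "\<exists>Z\<in>\<Y>. int (card Z) = y"
  proof (rule ccontr)
    assume "\<not> ?thesis"
    then have "card Z \<le> nat (y - 1)" if "Z \<in> \<Y>" for Z using Zy[OF that] that by force
    then have "(\<Sum>Z\<in>\<Y>. c Z) * (2 * int (nat (y - 1)) - 3) \<le>
        int (nat (y - 1)) * (int (nat (y - 1)) - 1) * (\<Sum>Z\<in>\<Y>. w Z)"
      unfolding c_def w_def using \<X>(3) finY by (intro cover_edges_rank_ratio) (force simp: \<Y>_def)+
    then have 1: "(\<Sum>Z\<in>\<Y>. c Z) * (2 * y - 5) \<le> (y - 1) * (y - 2) * (\<Sum>Z\<in>\<Y>. w Z)"
      using y1 by (simp add: algebra_simps)
    have "2 * int (card E2) * (2 * y - 5) \<le> (\<Sum>Z\<in>\<Y>. c Z) * (2 * y - 5)"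
      using E2 y_ge \<delta>(2) by (intro mult_right_mono) auto
    also have "\<dots> \<le> (y - 1) * (y - 2) * (2 * y - 1)"
      by (rule order_trans[OF 1]) (use WY y_ge \<delta>(2) in \<open>intro mult_left_mono; simp\<close>)
    also have "\<dots> < (y * (y - 1) + 2) * (2 * y - 5)"
      using y_ge \<delta>(2) by (simp add: algebra_simps)
    finally have lt: "2 * int (card E2) < y * (y - 1) + 2"
      using y_ge \<delta>(2) by (simp add: mult_less_cancel_right)
    \<comment> \<open>The ratio bound misses by less than 2, so parity closes the gap.\<close>
    have "even (y * (y - 1))" by auto
    then obtain k where "y * (y - 1) = 2 * k" by (elim evenE)
    then have "2 * int (card E2) \<le> y * (y - 1)" using lt by simp
    moreover have "0 \<le> 2 * (int s - int \<delta> - 1) * (y - int \<delta> - 1)"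
      using s_ge y_ge by (intro mult_nonneg_nonneg) auto
    ultimately show False using m m2 ident by linarith
  qed
  then obtain Z where Z: "Z \<in> \<Y>" "int (card Z) = y" by blast
  have Z': "Z \<in> \<X>" "Z \<noteq> X" using Z by (auto simp: \<Y>_def)
  \<comment> \<open>The weight left is (2 y - 1) - (2 y - 3) = 2. Weights are odd and positive, so
    at most two sets remain, each of weight 1 and hence a pair.\<close>
  define \<Z> where "\<Z> = \<Y> - {Z}"
  have WZ: "(\<Sum>U\<in>\<Z>. w U) \<le> 2"
    using WY sum.remove[OF finY Z(1), of w] Z(2) by (simp add: \<Z>_def w_def)
  have finZ: "finite \<Z>" using finY by (simp add: \<Z>_def)
  have "(\<Sum>U\<in>\<Z>. 1) \<le> (\<Sum>U\<in>\<Z>. w U)" using w1 by (intro sum_mono) (auto simp: \<Z>_def \<Y>_def)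
  then have cardZ: "card \<Z> \<le> 2" using WZ by simp
  have two: "card U = 2" if U: "U \<in> \<Z>" for U
  proof -
    have "w U \<le> (\<Sum>U\<in>\<Z>. w U)" using U finZ w1 by (intro member_le_sum) (force simp: \<Z>_def \<Y>_def)+
    then show ?thesis using WZ \<X>(3)[of U] U by (auto simp: \<Z>_def \<Y>_def w_def)
  qed
  have edges: "e \<subseteq> X \<or> e \<subseteq> Z \<or> e \<in> \<Z>" if e: "e \<in> ?E" for e
  proof -
    obtain U where U: "U \<in> \<X>" "e \<subseteq> U" using \<X>(5)[OF e] by blast
    have "e = U" if "U \<in> \<Z>"
      using card_subset_eq[OF fX[OF U(1)] U(2)] two[OF that] E(3)[OF e] by simp
    then show ?thesis using U by (auto simp: \<Z>_def \<Y>_def)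
  qed
  \<comment> \<open>If they met, some vertex would lie in neither set, and its at most two edges
    would all come from \<open>\<Z>\<close>.\<close>
  have disj: "X \<inter> Z = {}"
  proof (rule ccontr)
    assume "X \<inter> Z \<noteq> {}"
    then have "0 < card (X \<inter> Z)" using fX X(1) by (simp add: card_gt_0_iff)
    moreover have "card (X \<union> Z) + card (X \<inter> Z) = s + card Z"
      using card_Un_Int[of X Z] fX X Z' by simp
    ultimately have "card (X \<union> Z) < card ?V" using Z(2) by (simp add: y_def n_def)
    then have "X \<union> Z \<noteq> ?V" by auto
    moreover have "X \<union> Z \<subseteq> ?V" using \<X>(2) X(1) Z' by blast
    ultimately obtain v where v: "v \<in> ?V" "v \<notin> X" "v \<notin> Z" by blast
    have "{e \<in> ?E. v \<in> e} \<subseteq> \<Z>" using edges v by blast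
    then have "card {e \<in> ?E. v \<in> e} \<le> card \<Z>" by (rule card_mono[OF finZ])
    then show False using \<delta>(1)[OF v(1)] \<delta>(2) card_nbrs_eq_incident[OF G v(1)] cardZ by simp
  qed
  have un: "X \<union> Z = ?V"
  proof (rule card_subset_eq[OF V])
    show "X \<union> Z \<subseteq> ?V" using \<X>(2) X(1) Z' by blast
    have "card (X \<union> Z) = s + card Z" using card_Un_disjoint[OF _ _ disj] fX X Z' by simp
    then show "card (X \<union> Z) = card ?V" using Z(2) by (simp add: y_def n_def)
  qed
  have "2 * int (card E2) \<le> y * (y - 1) + 4"
  proof -
    have "(\<Sum>U\<in>\<Z>. c U) = (\<Sum>U\<in>\<Z>. 2)" using two by (intro sum.cong) (auto simp: c_def)
    also have "\<dots> \<le> 4" using cardZ by simp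
    finally show ?thesis using E2 sum.remove[OF finY Z(1), of c] Z(2) by (simp add: \<Z>_def c_def)
  qed
  moreover have "even ((int n - int \<delta> - 1) * (int n - int \<delta> - 2) + int \<delta> * (int \<delta> + 1))" by auto
  then obtain k where k: "(int n - int \<delta> - 1) * (int n - int \<delta> - 2) + int \<delta> * (int \<delta> + 1) = 2 * k"
    by (elim evenE)
  \<comment> \<open>A strict inequality between even numbers leaves a gap of 2, which lowers the
    bound on the product from below 2 to 1.\<close>
  have "2 * k + 2 \<le> 2 * int (card ?E)" using m unfolding k by simp
  ultimately have le1: "(int s - int \<delta> - 1) * (y - int \<delta> - 1) \<le> 1" using m2 ident k by linarith
  have size: "y = int \<delta> + 1 \<or> y = int \<delta> + 2 \<and> int s = int \<delta> + 2"
  proof (rule ccontr)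
    assume neg: "\<not> ?thesis"
    define a b where "a = int s - int \<delta> - 1" and "b = y - int \<delta> - 1"
    have "1 \<le> a" "1 \<le> b" using s_ge y_ge neg by (auto simp: a_def b_def)
    moreover have "a \<noteq> 1 \<or> b \<noteq> 1" using neg by (auto simp: a_def b_def)
    moreover have "a * 1 \<le> a * b" "1 * b \<le> a * b"
      using calculation(1,2) by (intro mult_mono; simp)+
    ultimately show False using le1 unfolding a_def[symmetric] b_def[symmetric] by linarith
  qed
  show thesis
  proof (rule that[OF un disj _ _ finZ cardZ edges])
    show "card Z = \<delta> + 1 \<or> card Z = \<delta> + 2 \<and> card X = \<delta> + 2" using size Z(2) X(2) by linarith
    show "3 \<le> card X" using s_ge X(2) \<delta>(2) by simp
  qed
qed

text \<open>Deleting an end of one crossing edge must leave another one, which gives distinct ends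
  in \<open>X\<close>. Were the ends in \<open>Z\<close> equal, deleting that common end would
  require a third crossing edge.\<close>

lemma two_crossing_edges:
  assumes G: "pair_graph G" and conn: "k_vertex_connected 2 G"
    and XZ: "X \<union> Z = pverts G" "X \<inter> Z = {}" and two: "2 \<le> card X" "2 \<le> card Z"
    and \<Z>: "finite \<Z>" "card \<Z> \<le> 2" "\<And>e. e \<in> edge_set G \<Longrightarrow> e \<subseteq> X \<or> e \<subseteq> Z \<or> e \<in> \<Z>"
  shows "\<exists>a\<in>X. \<exists>b\<in>Z. \<exists>a'\<in>X. \<exists>b'\<in>Z. a \<noteq> a' \<and> b \<noteq> b' \<and>
    (\<forall>u\<in>X. \<forall>v\<in>Z. (u, v) \<in> parcs G \<longrightarrow> (u, v) = (a, b) \<or> (u, v) = (a', b'))"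
proof -
  have in\<Z>: "{u, v} \<in> \<Z>" if "(u, v) \<in> parcs G" "u \<in> X" "v \<in> Z" for u v
  proof -
    have "\<not> {u, v} \<subseteq> X" "\<not> {u, v} \<subseteq> Z" using that XZ(2) by auto
    then show ?thesis using \<Z>(3)[of "{u, v}"] edge_set_facts(4)[OF G] that(1) by blast
  qed
  have no3: "e = f \<or> e = g \<or> f = g" if "e \<in> \<Z>" "f \<in> \<Z>" "g \<in> \<Z>" for e f g
  proof (rule ccontr)
    assume "\<not> ?thesis"
    then have "card {e, f, g} = 3" by simp
    moreover have "card {e, f, g} \<le> card \<Z>" using that \<Z>(1) by (intro card_mono) auto
    ultimately show False using \<Z>(2) by simp
  qed
  have "A - {v} \<noteq> {}" if "2 \<le> card A" for A :: "'a set" and v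
  proof
    assume "A - {v} = {}"
    then have "card A \<le> card {v}" by (intro card_mono) auto
    then show False using that by simp
  qed
  then have nonempty: "X - {v} \<noteq> {}" "Z - {v} \<noteq> {}" for v using two by blast+
  have ne: "X \<noteq> {}" "Z \<noteq> {}" using two by auto
  have "\<exists>u\<in>X. \<exists>v\<in>pverts G - {} - X. (u, v) \<in> parcs G"
    by (rule cut_arc[OF G conn]) (use XZ ne in auto)
  then obtain a b where ab: "a \<in> X" "b \<in> Z" "(a, b) \<in> parcs G" using XZ by blast
  have "\<exists>u\<in>X - {a}. \<exists>v\<in>pverts G - {a} - (X - {a}). (u, v) \<in> parcs G"
  proof (rule cut_arc[OF G conn])
    show "X - {a} \<noteq> pverts G - {a}" using XZ ab by blast
  qed (use XZ nonempty(1)[of a] ab in auto)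
  then obtain a' b' where ab': "a' \<in> X" "a' \<noteq> a" "b' \<in> Z" "(a', b') \<in> parcs G" using XZ by blast
  have bb': "b \<noteq> b'"
  proof
    assume eq: "b = b'"
    have "\<exists>u\<in>X. \<exists>v\<in>pverts G - {b} - X. (u, v) \<in> parcs G"
    proof (rule cut_arc[OF G conn])
      show "X \<noteq> pverts G - {b}" using XZ nonempty(2)[of b] by blast
    qed (use XZ ne ab in auto)
    then obtain c d where cd: "c \<in> X" "d \<in> Z" "d \<noteq> b" "(c, d) \<in> parcs G" using XZ by blast
    have "{a, b} \<noteq> {a', b'}" "{a, b} \<noteq> {c, d}" "{a', b'} \<noteq> {c, d}"
      using ab ab' cd eq XZ(2) by (auto simp: doubleton_eq_iff)
    then show False using no3[of "{a, b}" "{a', b'}" "{c, d}"] in\<Z> ab ab' cd by blast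
  qed
  have "(u, v) = (a, b) \<or> (u, v) = (a', b')" if uv: "(u, v) \<in> parcs G" "u \<in> X" "v \<in> Z" for u v
  proof -
    have "{a, b} \<noteq> {a', b'}" using ab ab' XZ(2) by (auto simp: doubleton_eq_iff)
    then have "{u, v} = {a, b} \<or> {u, v} = {a', b'}"
      using no3[of "{u, v}" "{a, b}" "{a', b'}"] in\<Z> ab ab' uv by blast
    then show ?thesis using ab ab' uv XZ(2) by (auto simp: doubleton_eq_iff)
  qed
  then show ?thesis
    using ab(1,2) ab'(1-3) bb'
    by (intro bexI[of _ a] bexI[of _ b] bexI[of _ a'] bexI[of _ b'] conjI ballI impI) simp_all
qed

theorem theorem1p1:
  fixes G :: "'a pair_pre_digraph" and n \<delta> :: nat
  assumes "pair_graph G"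
    and "k_vertex_connected 2 G"
    and "\<delta> = min_degree G"
    and "\<delta> \<ge> 6"
    and "n = card (pverts G)"
    and "n \<ge> 2 * \<delta> + 4"
    and "graph_spectral_radius G \<ge> graph_spectral_radius (B_graph n (\<delta> + 1) 2)"
    and "\<not> digraph_iso G (B_graph n (\<delta> + 1) 2)"
  shows "rigid_in_plane G"
proof (rule ccontr)
  assume nr: "\<not> rigid_in_plane G"
  let ?V = "pverts G" and ?B = "B_graph n (\<delta> + 1) 2" and ?r = "graph_spectral_radius G"
  note G = assms(1) and conn = assms(2)
  note V = pair_graph_facts(1)[OF G]
  have ne: "?V \<noteq> {}" using assms(4-6) by auto
  have deg: "\<delta> \<le> card (nbrs G u)" if "u \<in> ?V" for u
    using min_degree_le[OF G that] assms(3) by simp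
  have "real (n - (\<delta> + 1)) - 1 < graph_spectral_radius ?B"
    using assms(4,6) by (intro B_graph_spectral_radius_gt) auto
  then have r: "real n - real \<delta> - 2 < ?r" using assms(6,7) by (simp add: of_nat_diff)
  \<comment> \<open>The bounds r > n - \<delta> - 2 and r - (\<delta> - 1) > n - 2 \<delta> - 1 have
    positive right sides. After adding \<delta> (n - 1), their product is the number of arcs of the
    two complete graphs on n - \<delta> - 1 and \<delta> + 1 vertices.\<close>
  have "(real n - real \<delta> - 2) * (real n - 2 * real \<delta> - 1) < ?r * (?r - (real \<delta> - 1))"
    using r assms(4,6) by (intro mult_strict_mono) auto
  also have "\<dots> = ?r\<^sup>2 - (real \<delta> - 1) * ?r" by (simp add: power2_eq_square algebra_simps)
  also have "\<dots> \<le> 2 * real (card (edge_set G)) - real \<delta> * (real n - 1)"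
    using spectral_radius_edge_bound[OF G ne deg] assms(5) by simp
  finally have "(real n - real \<delta> - 1) * (real n - real \<delta> - 2) + real \<delta> * (real \<delta> + 1)
      < 2 * real (card (edge_set G))" by (simp add: algebra_simps)
  then have "real_of_int ((int n - int \<delta> - 1) * (int n - int \<delta> - 2) + int \<delta> * (int \<delta> + 1))
      < real_of_int (2 * int (card (edge_set G)))" by simp
  then have m: "(int n - int \<delta> - 1) * (int n - int \<delta> - 2) + int \<delta> * (int \<delta> + 1)
      < 2 * int (card (edge_set G))" by (simp only: of_int_less_iff)
  have two: "2 \<le> card ?V" using assms(5,6) by simp
  obtain \<X> where \<X>: "finite \<X>" "\<And>X. X \<in> \<X> \<Longrightarrow> X \<subseteq> ?V" "\<And>X. X \<in> \<X> \<Longrightarrow> 2 \<le> card X"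
    "\<And>X Y. X \<in> \<X> \<Longrightarrow> Y \<in> \<X> \<Longrightarrow> X \<noteq> Y \<Longrightarrow> card (X \<inter> Y) \<le> 1"
    "\<And>e. e \<in> edge_set G \<Longrightarrow> \<exists>X\<in>\<X>. e \<subseteq> X"
    "(\<Sum>X\<in>\<X>. 2 * card X - 3) + 4 \<le> 2 * card ?V"
    by (rule not_rigid_imp_cover[OF G nr two]) blast
  obtain X Z \<Z> where XZ: "X \<union> Z = ?V" "X \<inter> Z = {}"
    and size: "card Z = \<delta> + 1 \<or> card Z = \<delta> + 2 \<and> card X = \<delta> + 2" "3 \<le> card X"
    and \<Z>: "finite \<Z>" "card \<Z> \<le> 2" "\<And>e. e \<in> edge_set G \<Longrightarrow> e \<subseteq> X \<or> e \<subseteq> Z \<or> e \<in> \<Z>"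
    using cover_dichotomy[OF G conn deg assms(4) assms(6)[unfolded assms(5)] m[unfolded assms(5)] \<X>]
    by blast
  have fXZ: "finite X" "finite Z" using XZ(1) V by (metis finite_Un)+
  have cards: "card X + card Z = n" using card_Un_disjoint[OF fXZ XZ(2)] XZ(1) assms(5) by simp
  have two': "2 \<le> card X" "2 \<le> card Z" using size assms(4) by auto
  obtain a b a' b' where ab: "a \<in> X" "b \<in> Z" "a' \<in> X" "b' \<in> Z" "a \<noteq> a'" "b \<noteq> b'"
    and cross: "\<And>u v. (u, v) \<in> parcs G \<Longrightarrow> u \<in> X \<Longrightarrow> v \<in> Z \<Longrightarrow> (u, v) = (a, b) \<or> (u, v) = (a', b')"
    using two_crossing_edges[OF G conn XZ two' \<Z>] by metis
  have parts: "u \<in> X \<and> v \<in> X \<or> u \<in> Z \<and> v \<in> Z \<or> (u, v) \<in> {(a, b), (a', b'), (b, a), (b', a')}"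
    if uv: "(u, v) \<in> parcs G" for u v
    using cross[OF uv] cross[OF pair_graph_facts(5)[OF G uv]] pair_graph_facts(3,4)[OF G uv] XZ
    by blast
  show False
  proof (cases "card Z = \<delta> + 1")
    case True
    \<comment> \<open>The bijection must carry the two crossing edges to the matching edges
      \<open>(0, \<delta> + 1)\<close> and \<open>(1, \<delta> + 2)\<close>.\<close>
    have "card X = card {\<delta> + 1..<n}" using cards True by simp
    then obtain f where f: "bij_betw f X {\<delta> + 1..<n}" "f a = \<delta> + 1" "f a' = \<delta> + 2"
      using bij_betw_two_points[of X "{\<delta> + 1..<n}" a a' "\<delta> + 1" "\<delta> + 2"] fXZ ab assms(6) by auto
    have "card Z = card {..<\<delta> + 1}" using True by simp
    then obtain g where g: "bij_betw g Z {..<\<delta> + 1}" "g b = 0" "g b' = 1"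
      using bij_betw_two_points[of Z "{..<\<delta> + 1}" b b' 0 1] fXZ ab assms(4) by auto
    define h where "h v = (if v \<in> X then f v else g v)" for v
    have hX: "h v = f v" if "v \<in> X" for v using that by (simp add: h_def)
    have hZ: "h v = g v" if "v \<in> Z" for v using that XZ(2) by (auto simp: h_def)
    have hab: "h a = \<delta> + 1" "h a' = \<delta> + 2" "h b = 0" "h b' = 1"
      using hX hZ ab f g by auto
    have "bij_betw h (X \<union> Z) ({\<delta> + 1..<n} \<union> {..<\<delta> + 1})"
    proof (rule bij_betw_combine)
      show "bij_betw h X {\<delta> + 1..<n}" using f(1) hX by (simp cong: bij_betw_cong)
      show "bij_betw h Z {..<\<delta> + 1}" using g(1) hZ by (simp cong: bij_betw_cong)
    qed auto
    moreover have "{\<delta> + 1..<n} \<union> {..<\<delta> + 1} = pverts ?B"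
      using assms(6) by (auto simp: B_graph_def)
    ultimately have h: "bij_betw h ?V (pverts ?B)" using XZ(1) by simp
    have sub: "(h u, h v) \<in> parcs ?B" if uv: "(u, v) \<in> parcs G" for u v
    proof -
      have "u \<noteq> v" "u \<in> ?V" "v \<in> ?V" using pair_graph_facts[OF G] uv by auto
      then have "h u \<noteq> h v" using h by (auto simp: bij_betw_def dest: inj_onD)
      consider "u \<in> X" "v \<in> X" | "u \<in> Z" "v \<in> Z" | "(u, v) \<in> {(a, b), (a', b'), (b, a), (b', a')}"
        using parts[OF uv] by blast
      then show ?thesis
      proof cases
        case 1
        then have "h u \<in> {\<delta> + 1..<n}" "h v \<in> {\<delta> + 1..<n}" using f(1) hX by (auto simp: bij_betw_def)
        then show ?thesis using \<open>h u \<noteq> h v\<close> by (simp add: B_graph_def)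
      next
        case 2
        then have "h u \<in> {..<\<delta> + 1}" "h v \<in> {..<\<delta> + 1}" using g(1) hZ by (auto simp: bij_betw_def)
        then show ?thesis using \<open>h u \<noteq> h v\<close> by (simp add: B_graph_def)
      next
        case 3
        then show ?thesis using hab by (auto simp: B_graph_def)
      qed
    qed
    have "pair_graph ?B" using assms(4,6) by (intro pair_graph_B_graph) auto
    then have "parcs ?B = (\<lambda>(u, v). (h u, h v)) ` parcs G"
      by (intro spectral_radius_strict_mono[OF G conn _ _ h sub assms(7)]) auto
    then show False using digraph_iso_pairI[OF G h] assms(8) by blast
  next
    case False
    then have cXZ: "card X = \<delta> + 2" "card Z = \<delta> + 2" using size by auto
    have "card (nbrs G u) \<le> \<delta> + 2" if u: "u \<in> ?V" for u
    proof -
      define S where "S = (if u \<in> X then X else Z)"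
      \<comment> \<open>The only possible neighbour of \<open>u\<close> in the other part, since the
        crossing edges share no end; for vertices on no crossing edge it is a default. Hence the
        degree is at most (\<delta> + 1) + 1.\<close>
      define w where "w = (if u = a then b else if u = a' then b' else if u = b then a else a')"
      have "v = w" if v: "v \<in> nbrs G u - S" for v
        using parts[of u v] v u XZ ab unfolding S_def w_def nbrs_def by (auto split: if_splits)
      then have "nbrs G u \<subseteq> insert w (S - {u})"
        using pair_graph_facts(6)[OF G] by (auto simp: nbrs_def)
      moreover have "finite S" using fXZ by (simp add: S_def)
      ultimately have "card (nbrs G u) \<le> card (insert w (S - {u}))" by (intro card_mono) auto
      also have "\<dots> \<le> Suc (card (S - {u}))" by (rule card_insert_le_m1[OF _ _, THEN le_trans]) auto
      also have "u \<in> S" using u XZ by (auto simp: S_def)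
      then have "Suc (card (S - {u})) = card S" using \<open>finite S\<close> by (rule card.remove[symmetric, rotated])
      also have "card S = \<delta> + 2" using cXZ by (simp add: S_def)
      finally show ?thesis .
    qed
    then have "?r \<le> real (\<delta> + 2)" by (rule spectral_radius_le_max_degree[OF G ne])
    then show False using r cXZ cards by simp
  qed
qed

end
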